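(* Let $Q\in\mathbb{R}^{2\times2}_{sym}$ with $\det Q<0$, let $\delta\in\mathbb{R}$, and let $\mathcal{U}\subset\Pi_Q:=\{M\in\mathbb{R}^{2\times2}_{sym}\;|\;\langle Q,M\rangle=\delta\}$ be a set of four distinct wells (matrices) such that every element of $\mathcal{U}$ is compatible with at least one other element of $\mathcal{U}$, and $\mathcal{U}$ is not in a wedge configuration. Assume further that there exist two different subsets $\{V_1,V_2\},\{W_1,W_2\}\subset\mathcal{U}$, each consisting of two distinct rank-one compatible wells, and let $D=C(\{W_1,W_2\})\cup C(\{V_1,V_2\})$. If any one of the following conditions holds: 1. the set $D$ is disconnected; 2. $D$ is a connected set and $\mathcal{U}\subset D$; 3. the intersection of the sets $\{V_1,V_2\}$ and $\{W_1,W_2\}$ has only one element, say $V$, and $D$ is contained either in the upper part or in the lower part of $\partial(\mathscr{C}_Q(V))$, i.e. $D\subset\partial(\mathscr{C}_Q(V))\cap\mathscr{C}_Q^+(V)$ or $D\subset\partial(\mathscr{C}_Q(V))\cap\mathscr{C}_Q^-(V)$; then $L^e(\mathcal{U})=Q^e(\mathcal{U})$.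
   Context: $\mathbb{R}^{2\times 2}_{sym}$ is the space of real symmetric $2\times2$ matrices with the Frobenius inner product $\langle\cdot,\cdot\rangle$; $C(\cdot)$ denotes the convex hull and $\operatorname{rel\,int}$ the relative interior. Compatibility. Two matrices $M_1,M_2\in\mathbb{R}^{2\times2}_{sym}$ are compatible if there is a skew-symmetric $S$ with $\operatorname{rank}(M_1-M_2+S)\le 1$ (equivalently, $\det(M_1-M_2)\le 0$), and incompatible otherwise (equivalently, $\det(M_1-M_2)>0$). They are rank-one compatible if $\operatorname{rank}(M_1-M_2)\le1$, i.e. $\det(M_1-M_2)=0$. A matrix counts as compatible with itself. Planar compatible cone. For $U\in\Pi_Q$, $\mathscr{C}_Q(U)=\{V\in\Pi_Q\;|\;\det(V-U)\le 0\}$, and $\partial(\mathscr{C}_Q(U))$ is its boundary relative to $\Pi_Q$. For $v\in\mathbb{R}^2$, $v^\perp$ is the counter-clockwise rotation of $v$ by $\pi/2$. Since $\det Q<0$, there exist linearly independent unit vectors $a,n\in\mathbb{R}^2$ with $\langle Q,a^\perp\otimes a^\perp\rangle=\langle Q,n^\perp\otimes n^\perp\rangle=0$, and $\{a^\perp\otimes a^\perp,n^\perp\otimes n^\perp\}$ is a basis of the linear subspace parallel to $\Pi_Q$; fix such $a,n$. The upper and lower parts of $\mathscr{C}_Q(U)$ are $$\mathscr{C}^+_Q(U)=\{U+\xi\, a^\perp\otimes a^\perp+\eta\, n^\perp\otimes n^\perp\;|\;\xi\ge0\ge\eta\},\qquad \mathscr{C}^-_Q(U)=\{U+\xi\, a^\perp\otimes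 a^\perp+\eta\, n^\perp\otimes n^\perp\;|\;\eta\ge0\ge\xi\}.$$ Wedge configuration. A set of four wells in $\mathbb{R}^{2\times2}_{sym}$ is in a wedge configuration if its elements can be labeled $U_0,U_1,U_2,U_3$ so that, with $\mathcal{V}=\{U_1,U_2,U_3\}$: exactly one of the three pairs of wells in $\mathcal{V}$ is incompatible, $U_0\in\operatorname{rel\,int}C(\mathcal{V})$, and $U_0$ is rank-one compatible with each of the two elements of the incompatible pair. Symmetric lamination convex hull. $L^{e,0}(\mathcal{U})=\mathcal{U}$, $L^{e,i+1}(\mathcal{U})=\{\lambda A+(1-\lambda)B\;|\;\lambda\in[0,1],\ A,B\in L^{e,i}(\mathcal{U})\text{ compatible}\}$, and $L^e(\mathcal{U})=\bigcup_{i\ge0}L^{e,i}(\mathcal{U})$. Symmetric quasiconvex hull. For a differentiable $\phi$ with values in $\mathbb{R}^2$, $e(D\phi)=(D\phi+(D\phi)^T)/2$. A Borel measurable, locally bounded function $f:\mathbb{R}^{2\times2}_{sym}\to\mathbb{R}$ is symmetric quasiconvex if for every $U\in\mathbb{R}^{2\times2}_{sym}$ $$f(U)\le\inf\left\{\frac1{|\Omega|}\int_\Omega f(U+e(D\phi))\,dx\;\middle|\;\phi\in C_0^\infty(\Omega,\mathbb{R}^2)\right\},$$ where $\Omega\subset\mathbb{R}^2$ is a bounded domain. For compact $\mathcal{U}\subset\mathbb{R}^{2\times2}_{sym}$, $$Q^e(\mathcal{U})=\{A\in\mathbb{R}^{2\times2}_{sym}\;|\;f(A)\le\sup_{B\in\mathcal{U}}f(B)\text{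 for every symmetric quasiconvex }f:\mathbb{R}^{2\times 2}_{sym}\to\mathbb{R}\}.$$ *)

theory Defs
  imports "HOL-Analysis.Analysis"
begin

text \<open>Matrices are elements of \<^typ>\<open>real^2^2\<close>. The library inner product on this type is the
  sum of the inner products of the rows, i.e. the Frobenius inner product.\<close>

definition sym_matrices :: "(real^2^2) set" where
  "sym_matrices = {M. transpose M = M}"

definition wells_plane :: "real^2^2 \<Rightarrow> real \<Rightarrow> (real^2^2) set" where
  "wells_plane Q \<delta> = {M \<in> sym_matrices. Q \<bullet> M = \<delta>}"

definition compatible :: "real^2^2 \<Rightarrow> real^2^2 \<Rightarrow> bool" where
  "compatible M N \<longleftrightarrow> (\<exists>S. transpose S = - S \<and> rank (M - N + S) \<le> 1)"

definition rank_one_compatible :: "real^2^2 \<Rightarrow> real^2^2 \<Rightarrow> bool" where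
  "rank_one_compatible M N \<longleftrightarrow> rank (M - N) \<le> 1"

definition perp :: "real^2 \<Rightarrow> real^2" where
  "perp v = vector [- (v $ 2), v $ 1]"

definition tensor :: "real^2 \<Rightarrow> real^2 \<Rightarrow> real^2^2" where
  "tensor v w = (\<chi> i j. v $ i * w $ j)"

definition planar_cone :: "real^2^2 \<Rightarrow> real \<Rightarrow> real^2^2 \<Rightarrow> (real^2^2) set" where
  "planar_cone Q \<delta> U = {V \<in> wells_plane Q \<delta>. det (V - U) \<le> 0}"

definition planar_cone_boundary :: "real^2^2 \<Rightarrow> real \<Rightarrow> real^2^2 \<Rightarrow> (real^2^2) set" where
  "planar_cone_boundary Q \<delta> U = top_of_set (wells_plane Q \<delta>) frontier_of planar_cone Q \<delta> U"

text \<open>The unit vectors \<open>a\<close> and \<open>n\<close> are determined by \<open>Q\<close> only up to sign and order.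
  Exchanging them exchanges the upper and the lower part.\<close>

definition cone_frame :: "real^2^2 \<Rightarrow> real^2 \<Rightarrow> real^2 \<Rightarrow> bool" where
  "cone_frame Q a n \<longleftrightarrow>
     norm a = 1 \<and> norm n = 1 \<and> a \<noteq> n \<and> independent {a, n} \<and>
     Q \<bullet> tensor (perp a) (perp a) = 0 \<and> Q \<bullet> tensor (perp n) (perp n) = 0"

definition upper_cone :: "real^2 \<Rightarrow> real^2 \<Rightarrow> real^2^2 \<Rightarrow> (real^2^2) set" where
  "upper_cone a n U =
     {U + \<xi> *\<^sub>R tensor (perp a) (perp a) + \<eta> *\<^sub>R tensor (perp n) (perp n) | \<xi> \<eta>. \<xi> \<ge> 0 \<and> 0 \<ge> \<eta>}"

definition lower_cone :: "real^2 \<Rightarrow> real^2 \<Rightarrow> real^2^2 \<Rightarrow> (real^2^2) set" where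
  "lower_cone a n U =
     {U + \<xi> *\<^sub>R tensor (perp a) (perp a) + \<eta> *\<^sub>R tensor (perp n) (perp n) | \<xi> \<eta>. \<eta> \<ge> 0 \<and> 0 \<ge> \<xi>}"

definition wedge_configuration :: "(real^2^2) set \<Rightarrow> bool" where
  "wedge_configuration \<U> \<longleftrightarrow>
     (\<exists>U0 U1 U2 U3. distinct [U0, U1, U2, U3] \<and> \<U> = {U0, U1, U2, U3} \<and>
        (\<exists>P. {p. p \<subseteq> {U1, U2, U3} \<and> card p = 2 \<and> (\<exists>A\<in>p. \<exists>B\<in>p. \<not> compatible A B)} = {P} \<and>
             U0 \<in> rel_interior (convex hull {U1, U2, U3}) \<and>
             (\<forall>M\<in>P. rank_one_compatible U0 M)))"

primrec lam_iter :: "nat \<Rightarrow> (real^2^2) set \<Rightarrow> (real^2^2) set" where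
  "lam_iter 0 \<U> = \<U>"
| "lam_iter (Suc i) \<U> =
     {l *\<^sub>R A + (1 - l) *\<^sub>R B | l A B.
        l \<in> {0..1} \<and> A \<in> lam_iter i \<U> \<and> B \<in> lam_iter i \<U> \<and> compatible A B}"

definition sym_lam_hull :: "(real^2^2) set \<Rightarrow> (real^2^2) set" where
  "sym_lam_hull \<U> = (\<Union>i. lam_iter i \<U>)"

primrec C_k :: "nat \<Rightarrow> ('a::real_normed_vector \<Rightarrow> 'b::real_normed_vector) \<Rightarrow> bool" where
  "C_k 0 f \<longleftrightarrow> continuous_on UNIV f"
| "C_k (Suc k) f \<longleftrightarrow>
     (\<forall>x. f differentiable at x) \<and> (\<forall>v. C_k k (\<lambda>x. frechet_derivative f (at x) v))"

text \<open>\<open>C\<^sub>0\<^sup>\<infinity>(\<Omega>, \<real>\<^sup>2)\<close>: smooth functions whose support is a compact subset of \<open>\<Omega>\<close>, extended by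
  zero to the whole plane.\<close>

definition test_functions :: "(real^2) set \<Rightarrow> (real^2 \<Rightarrow> real^2) set" where
  "test_functions \<Omega> =
     {\<phi>. (\<forall>k. C_k k \<phi>) \<and> compact (closure {x. \<phi> x \<noteq> 0}) \<and> closure {x. \<phi> x \<noteq> 0} \<subseteq> \<Omega>}"

definition sym_grad :: "(real^2 \<Rightarrow> real^2) \<Rightarrow> real^2 \<Rightarrow> real^2^2" where
  "sym_grad \<phi> x = (1/2) *\<^sub>R (jacobian \<phi> (at x) + transpose (jacobian \<phi> (at x)))"

text \<open>Functions on the symmetric matrices are total functions of which only the values on
  \<^const>\<open>sym_matrices\<close> matter. Infima and suprema are taken in \<^typ>\<open>ereal\<close> because the infimum
  below can be \<open>-\<infinity>\<close>. Quasiconvexity is required for all bounded domains \<open>\<Omega>\<close>; by the usual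
  scaling argument the condition does not depend on \<open>\<Omega>\<close>.\<close>

definition locally_bounded_sym :: "(real^2^2 \<Rightarrow> real) \<Rightarrow> bool" where
  "locally_bounded_sym f \<longleftrightarrow>
     (\<forall>A\<in>sym_matrices. \<exists>r>0. bounded (f ` (ball A r \<inter> sym_matrices)))"

definition sym_quasiconvex :: "(real^2^2 \<Rightarrow> real) \<Rightarrow> bool" where
  "sym_quasiconvex f \<longleftrightarrow>
     f \<in> borel_measurable (restrict_space borel sym_matrices) \<and> locally_bounded_sym f \<and>
     (\<forall>\<Omega>. open \<Omega> \<and> connected \<Omega> \<and> bounded \<Omega> \<and> \<Omega> \<noteq> {} \<longrightarrow>
        (\<forall>U\<in>sym_matrices.
           ereal (f U) \<le> (INF \<phi>\<in>test_functions \<Omega>.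
             ereal (1 / measure lborel \<Omega> * (LINT x:\<Omega>|lborel. f (U + sym_grad \<phi> x))))))"

definition sym_qc_hull :: "(real^2^2) set \<Rightarrow> (real^2^2) set" where
  "sym_qc_hull \<U> =
     {A \<in> sym_matrices. \<forall>f. sym_quasiconvex f \<longrightarrow> ereal (f A) \<le> (SUP B\<in>\<U>. ereal (f B))}"

end

(* The function E |-> l . E - k det E with k >= 0 is symmetric quasiconvex, because the integral of
   det (D phi) vanishes and det (e (D phi)) = det (D phi) - w^2, where w is the skew part of D phi.
   Separating (A, - det A) from the points (U, - det U) by such functions, every A in the quasiconvex
   hull is a convex combination of wells whose averaged determinant is at most det A. In each of the
   three configurations such a combination splits into compatible steps: if the wells form two
   rank-one compatible pairs, the barycentres of the pairs are compatible; otherwise three wells lie on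
   a rank-one line, which reduces to the previous case, or form an L whose legs lie on the boundary
   of one half of the cone, and the position of the fourth well is limited by the exclusion of wedges and of isolated wells. The other inclusion is convexity of
   symmetric quasiconvex functions along compatible segments, tested with one tent-shaped layer on a
   long rectangle: the gradient takes the two prescribed values exactly, except on a vanishing
   fraction where it stays bounded, so no continuity of the function is needed. *)

theory Submission
  imports Defs "HOL-Real_Asymp.Real_Asymp"
begin

section \<open>Compatible matrices and lamination hulls\<close>

text \<open>The obstacle is that \<open>sym_qc_hull\<close> ranges over a class of functions that
  cannot be listed. Testing with affine functions of E and det E alone could be too weak; here it is
  enough because the resulting bound is already reached by laminates. The upper bound thus becomes a
  finite problem about weights, \<open>mixtures_in_lam_hull\<close>, in which no function occurs.
  That problem is planar. Since det Q < 0, the direction space of the plane of wells is spanned by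
  two rank-one matrices, so det has no pure squares on it: in coordinates (x, y) along them, one
  sign reversed, the determinant of a difference is a negative multiple of (x1 - x2) * (y1 - y2).
  Compatible then means comparable in the product order, rank-one compatible means on a common
  horizontal or vertical line, and the lamination hull is closed under segments between comparable
  points. With the common well of the two pairs as origin, the condition on the averaged determinant
  becomes a bound on the product X * Y of the coordinates of the mixture, and the L-shaped case is a
  case split on the signs of the coordinates of the fourth well.\<close>

lemma sym_matrices_iff: "M \<in> sym_matrices \<longleftrightarrow> M $ 1 $ 2 = M $ 2 $ 1"
  by (auto simp: sym_matrices_def vec_eq_iff forall_2 transpose_def)

lemma rank_le_1_iff_det:
  fixes M :: "real^2^2"
  shows "rank M \<le> 1 \<longleftrightarrow> det M = 0"
  using det_eq_0_rank[of M] by auto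

lemma skew_entries:
  fixes S :: "real^2^2"
  assumes "transpose S = - S"
  shows "S$1$1 = 0" "S$2$2 = 0" "S$2$1 = - (S$1$2)"
proof -
  have "S$j$i = - (S$i$j)" for i j
    using arg_cong[OF assms, of "\<lambda>M. M $ i $ j"] by (simp add: transpose_def)
  from this[of 1 1] this[of 2 2] this[of 2 1] show "S$1$1 = 0" "S$2$2 = 0" "S$2$1 = - (S$1$2)"
    by simp_all
qed

text \<open>A skew \<open>S\<close> has one free entry s, and adding it to a symmetric matrix raises
  the determinant by s^2. So the determinant can be brought to zero exactly when it starts out at
  most zero.\<close>

lemma compatible_iff_det:
  assumes "M \<in> sym_matrices" "N \<in> sym_matrices"
  shows "compatible M N \<longleftrightarrow> det (M - N) \<le> 0"
proof
  assume "compatible M N"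
  then obtain S where S: "transpose S = - S" and d: "det (M - N + S) = 0"
    unfolding compatible_def rank_le_1_iff_det by blast
  have "S$1$1 = 0" "S$2$2 = 0" "S$2$1 = - (S$1$2)"
    using skew_entries[OF S] by blast+
  then have "det (M - N + S) = det (M - N) + (S$1$2)^2"
    using assms by (simp add: det_2 sym_matrices_iff power2_eq_square algebra_simps)
  with d show "det (M - N) \<le> 0"
    by (smt (verit) zero_le_power2)
next
  assume le: "det (M - N) \<le> 0"
  define s where "s = sqrt (- det (M - N))"
  define S :: "real^2^2" where "S = vector [vector [0, s], vector [- s, 0]]"
  have "transpose S = - S"
    by (simp add: vec_eq_iff forall_2 transpose_def S_def)
  moreover have "det (M - N + S) = det (M - N) + s^2"
    using assms by (simp add: det_2 sym_matrices_iff power2_eq_square algebra_simps S_def)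
  then have "det (M - N + S) = 0"
    using le by (simp add: s_def)
  ultimately show "compatible M N"
    unfolding compatible_def rank_le_1_iff_det by blast
qed

text \<open>The singular matrix \<open>M - N + S\<close> factors into a tensor of two vectors, and
  taking symmetric parts removes \<open>S\<close>. The vector \<open>m\<close> later serves as
  normal of the layers.\<close>

lemma compatible_rank_one_decomposition:
  assumes "M \<in> sym_matrices" "N \<in> sym_matrices" "compatible M N"
  obtains c m where "M - N = (1/2) *\<^sub>R (tensor c m + tensor m c)"
proof -
  obtain S where S: "transpose S = - S" and d: "det (M - N + S) = 0"
    using assms(3) unfolding compatible_def rank_le_1_iff_det by blast
  have s: "S$1$1 = 0" "S$2$2 = 0" "S$2$1 = - (S$1$2)"
    using skew_entries[OF S] by blast+
  define R where "R = M - N + S"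
  have R: "M - N = (1/2) *\<^sub>R (R + transpose R)"
    using assms s by (simp add: R_def vec_eq_iff forall_2 transpose_def sym_matrices_iff)
  have d: "R$1$1 * R$2$2 = R$1$2 * R$2$1"
    using d by (simp add: R_def det_2)
  obtain c m where "R = tensor c m"
  proof (cases "R$1 = 0")
    case True
    then have "R = tensor (vector [0, 1]) (R$2)"
      by (simp add: vec_eq_iff forall_2 tensor_def)
    then show ?thesis using that by blast
  next
    case False
    \<comment> \<open>The rows of a singular matrix are dependent; the factor is read off in a
      column where the first row does not vanish.\<close>
    have "\<exists>k. R$2 = k *\<^sub>R R$1"
    proof (cases "R$1$1 = 0")
      case True
      with False d show ?thesis
        by (intro exI[of _ "R$2$2 / R$1$2"]) (auto simp: vec_eq_iff forall_2)
    next
      case False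
      with d show ?thesis
        by (intro exI[of _ "R$2$1 / R$1$1"]) (auto simp: vec_eq_iff forall_2 field_simps)
    qed
    then obtain k where "R$2 = k *\<^sub>R R$1" by blast
    then have "R = tensor (vector [1, k]) (R$1)"
      by (simp add: vec_eq_iff forall_2 tensor_def)
    then show ?thesis using that by blast
  qed
  moreover have "transpose (tensor c m) = tensor m c"
    by (simp add: vec_eq_iff transpose_def tensor_def)
  ultimately show ?thesis using that R by metis
qed

lemma sym_matrices_add [simp]: "A \<in> sym_matrices \<Longrightarrow> B \<in> sym_matrices \<Longrightarrow> A + B \<in> sym_matrices"
  and sym_matrices_diff [simp]: "A \<in> sym_matrices \<Longrightarrow> B \<in> sym_matrices \<Longrightarrow> A - B \<in> sym_matrices"
  and sym_matrices_scaleR [simp]: "A \<in> sym_matrices \<Longrightarrow> r *\<^sub>R A \<in> sym_matrices"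
  by (auto simp: sym_matrices_iff)

lemma compatible_refl [simp]: "compatible A A"
  unfolding compatible_def rank_le_1_iff_det
  by (intro exI[of _ 0]) (auto simp: det_2 transpose_def vec_eq_iff)

lemma lam_iter_Suc_superset: "lam_iter i \<U> \<subseteq> lam_iter (Suc i) \<U>"
proof
  fix A assume "A \<in> lam_iter i \<U>"
  then show "A \<in> lam_iter (Suc i) \<U>"
    by (simp only: lam_iter.simps mem_Collect_eq, intro exI[of _ 1] exI[of _ A]) auto
qed

lemma lam_iter_mono: "i \<le> j \<Longrightarrow> lam_iter i \<U> \<subseteq> lam_iter j \<U>"
  by (rule lift_Suc_mono_le[of "\<lambda>i. lam_iter i \<U>", OF lam_iter_Suc_superset])

lemma subset_sym_lam_hull: "\<U> \<subseteq> sym_lam_hull \<U>"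
  unfolding sym_lam_hull_def by (metis UN_upper UNIV_I lam_iter.simps(1))

text \<open>The iterates are nested, so points reached at different depths are both available at the
  larger depth.\<close>

lemma sym_lam_hull_segment:
  assumes "A \<in> sym_lam_hull \<U>" "B \<in> sym_lam_hull \<U>" "compatible A B" "u \<ge> 0" "v \<ge> 0" "u + v = 1"
  shows "u *\<^sub>R A + v *\<^sub>R B \<in> sym_lam_hull \<U>"
proof -
  obtain i j where ij: "A \<in> lam_iter i \<U>" "B \<in> lam_iter j \<U>"
    using assms(1,2) by (auto simp: sym_lam_hull_def)
  have "A \<in> lam_iter (max i j) \<U>" "B \<in> lam_iter (max i j) \<U>"
    using ij lam_iter_mono[of i "max i j"] lam_iter_mono[of j "max i j"] by auto
  moreover have "v = 1 - u" "u \<in> {0..1}" using assms(4-6) by auto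
  ultimately have "u *\<^sub>R A + v *\<^sub>R B \<in> lam_iter (Suc (max i j)) \<U>"
    using assms(3) by (simp only: lam_iter.simps) blast
  then show ?thesis unfolding sym_lam_hull_def by blast
qed

lemma sym_lam_hull_subset_sym: 
  assumes "\<U> \<subseteq> sym_matrices" shows "sym_lam_hull \<U> \<subseteq> sym_matrices"
proof -
  have "lam_iter i \<U> \<subseteq> sym_matrices" for i
    by (induction i) (use assms in \<open>auto simp: subset_iff intro!: sym_matrices_add sym_matrices_scaleR\<close>)
  then show ?thesis by (auto simp: sym_lam_hull_def)
qed

section \<open>Smooth functions of one and several variables\<close>

lemma C_k_SucD: "C_k (Suc k) f \<Longrightarrow> C_k k f"
proof (induction k arbitrary: f)
  case 0
  then show ?case
    by (auto simp: continuous_on_eq_continuous_within intro: differentiable_imp_continuous_within)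
next
  case (Suc k)
  then show ?case by (metis C_k.simps(2))
qed

text \<open>\<open>C_k\<close> recurses through \<open>frechet_derivative\<close>; by uniqueness of
  the derivative any explicit formula \<open>F\<close> may replace it, which drives the inductive
  closure proofs.\<close>

lemma C_k_SucI:
  assumes "\<And>x. (f has_derivative F x) (at x)" "\<And>v. C_k k (\<lambda>x. F x v)"
  shows "C_k (Suc k) f"
proof -
  have "frechet_derivative f (at x) = F x" for x
    using frechet_derivative_at[OF assms(1)] by simp
  then show ?thesis
    using assms by (auto simp: differentiable_def)
qed

lemma C_k_SucD1: "C_k (Suc k) f \<Longrightarrow> (f has_derivative frechet_derivative f (at x)) (at x)"
  and C_k_SucD2: "C_k (Suc k) f \<Longrightarrow> C_k k (\<lambda>x. frechet_derivative f (at x) v)"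
  by (auto simp: frechet_derivative_works)

lemma C_k_const: "C_k k (\<lambda>x. c)"
  by (induction k arbitrary: c) (auto intro!: C_k_SucI derivative_intros simp del: C_k.simps(2))

lemma C_k_bounded_linear:
  assumes "bounded_linear L" shows "C_k k L"
proof (cases k)
  case 0
  then show ?thesis using assms by (simp add: linear_continuous_on)
next
  case (Suc j)
  show ?thesis unfolding Suc
    by (rule C_k_SucI[OF bounded_linear_imp_has_derivative[OF assms] C_k_const])
qed

lemma C_k_add: "C_k k f \<Longrightarrow> C_k k g \<Longrightarrow> C_k k (\<lambda>x. f x + g x)"
proof (induction k arbitrary: f g)
  case 0
  then show ?case by (auto intro: continuous_intros)
next
  case (Suc k)
  define F where "F = (\<lambda>x. frechet_derivative f (at x))"
  have F: "(f has_derivative F x) (at x)" "C_k k (\<lambda>x. F x v)" for x v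
    using Suc.prems(1) by (auto simp: F_def C_k_SucD1 C_k_SucD2 simp del: C_k.simps)
  define G where "G = (\<lambda>x. frechet_derivative g (at x))"
  have G: "(g has_derivative G x) (at x)" "C_k k (\<lambda>x. G x v)" for x v
    using Suc.prems(2) by (auto simp: G_def C_k_SucD1 C_k_SucD2 simp del: C_k.simps)
  show ?case
    by (rule C_k_SucI[where F = "\<lambda>x v. F x v + G x v"]) (rule has_derivative_add F G Suc.IH)+
qed

lemma C_k_scaleR: "C_k k f \<Longrightarrow> C_k k g \<Longrightarrow> C_k k (\<lambda>x. f x *\<^sub>R g x)"
proof (induction k arbitrary: f g)
  case 0
  then show ?case by (auto intro: continuous_intros)
next
  case (Suc k)
  define F where "F = (\<lambda>x. frechet_derivative f (at x))"
  have F: "(f has_derivative F x) (at x)" "C_k k (\<lambda>x. F x v)" for x v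
    using Suc.prems(1) by (auto simp: F_def C_k_SucD1 C_k_SucD2 simp del: C_k.simps)
  define G where "G = (\<lambda>x. frechet_derivative g (at x))"
  have G: "(g has_derivative G x) (at x)" "C_k k (\<lambda>x. G x v)" for x v
    using Suc.prems(2) by (auto simp: G_def C_k_SucD1 C_k_SucD2 simp del: C_k.simps)
  show ?case
  proof (rule C_k_SucI[where F = "\<lambda>x v. f x *\<^sub>R G x v + F x v *\<^sub>R g x"])
    show "C_k k (\<lambda>x. f x *\<^sub>R G x v + F x v *\<^sub>R g x)" for v
      by (rule F(2) G(2) C_k_SucD[OF Suc.prems(1)] C_k_SucD[OF Suc.prems(2)] C_k_add Suc.IH)+
  qed (rule has_derivative_scaleR F G)+
qed

lemma C_k_mult: "C_k k f \<Longrightarrow> C_k k g \<Longrightarrow> C_k k (\<lambda>x. f x * g x :: real)"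
  using C_k_scaleR[of k f g] by simp

lemma C_k_diff: "C_k k f \<Longrightarrow> C_k k g \<Longrightarrow> C_k k (\<lambda>x. f x - g x)"
  using C_k_add[OF _ C_k_scaleR[OF C_k_const[of k "-1"]], of f g] by simp

text \<open>For an affine inner map the directional derivative has the same shape as the function
  itself, so the induction needs no product rule.\<close>

lemma C_k_affine_compose:
  assumes "bounded_linear L"
  shows "C_k k f \<Longrightarrow> C_k k (\<lambda>x. f (L x + c))"
proof (induction k arbitrary: f)
  case 0
  then show ?case
    using linear_continuous_on[OF assms]
    by (auto intro!: continuous_on_compose2[of UNIV f] continuous_intros)
next
  case (Suc k)
  define F where "F = (\<lambda>x. frechet_derivative f (at x))"
  have F: "(f has_derivative F x) (at x)" "C_k k (\<lambda>x. F x v)" for x v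
    using Suc.prems(1) by (auto simp: F_def C_k_SucD1 C_k_SucD2 simp del: C_k.simps)
  show ?case
  proof (rule C_k_SucI[where F = "\<lambda>x v. F (L x + c) (L v)"])
    show "((\<lambda>x. f (L x + c)) has_derivative (\<lambda>v. F (L x + c) (L v))) (at x)" for x
    proof -
      have "((\<lambda>x. L x + c) has_derivative L) (at x)"
        using has_derivative_add[OF bounded_linear_imp_has_derivative[OF assms] has_derivative_const]
        by simp
      from diff_chain_at[OF this F(1)] show ?thesis by (simp add: o_def)
    qed
    show "C_k k (\<lambda>x. F (L x + c) (L v))" for v
      by (rule Suc.IH) (rule F(2))
  qed
qed

lemma C_k_inverse:
  fixes f :: "'a::real_normed_vector \<Rightarrow> real"
  assumes nz: "\<And>x. f x \<noteq> 0"
  shows "C_k k f \<Longrightarrow> C_k k (\<lambda>x. inverse (f x))"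
proof (induction k)
  case 0
  then show ?case using nz by (auto intro: continuous_intros)
next
  case (Suc k)
  define F where "F = (\<lambda>x. frechet_derivative f (at x))"
  have F: "(f has_derivative F x) (at x)" "C_k k (\<lambda>x. F x v)" for x v
    using Suc.prems(1) by (auto simp: F_def C_k_SucD1 C_k_SucD2 simp del: C_k.simps)
  have IH: "C_k k (\<lambda>x. inverse (f x))" using Suc C_k_SucD by blast
  show ?case
  proof (rule C_k_SucI[where F = "\<lambda>x v. -1 * (inverse (f x) * F x v * inverse (f x))"])
    show "C_k k (\<lambda>x. -1 * (inverse (f x) * F x v * inverse (f x)))" for v
      by (rule C_k_const F(2) IH C_k_mult)+
  qed (use F nz in \<open>auto intro!: derivative_eq_intros\<close>)
qed

lemma C_k_real_SucI:
  fixes f :: "real \<Rightarrow> real"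
  assumes "\<And>x. (f has_real_derivative f' x) (at x)" "C_k k f'"
  shows "C_k (Suc k) f"
  by (rule C_k_SucI[where F = "\<lambda>x v. f' x * v"])
     (use assms in \<open>auto simp: has_field_derivative_def intro: C_k_mult C_k_const\<close>)

lemma C_k_real_SucE:
  fixes f :: "real \<Rightarrow> real"
  assumes "C_k (Suc k) f"
  obtains f' where "\<And>x. (f has_real_derivative f' x) (at x)" "C_k k f'"
proof -
  define F where "F = (\<lambda>x. frechet_derivative f (at x))"
  have F: "(f has_derivative F x) (at x)" "C_k k (\<lambda>x. F x v)" for x v
    using assms(1) by (auto simp: F_def C_k_SucD1 C_k_SucD2 simp del: C_k.simps)
  have "F x = (*) (F x 1)" for x
  proof
    fix v
    show "F x v = F x 1 * v"
      using linear_cmul[OF has_derivative_linear[OF F(1)], of x v 1] by (simp add: mult.commute)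
  qed
  then have "(f has_real_derivative F x 1) (at x)" for x
    using F(1)[of x] unfolding has_field_derivative_def by metis
  then show ?thesis by (rule that) (rule F(2))
qed

section \<open>A smooth step built from exp(-1/t)\<close>

definition flat_fun :: "nat \<Rightarrow> real \<Rightarrow> real" where
  "flat_fun n t = (if t > 0 then exp (- inverse t) * inverse t ^ n else 0)"

lemma flat_fun_tendsto_0: "((flat_fun n) \<longlongrightarrow> 0) (at 0)"
proof -
  have "((\<lambda>u::real. u ^ n / exp u) \<longlongrightarrow> 0) at_top"
    by (rule tendsto_power_div_exp_0)
  then have "((\<lambda>t::real. inverse t ^ n / exp (inverse t)) \<longlongrightarrow> 0) (at_right 0)"
    by (rule filterlim_compose) (rule filterlim_inverse_at_top_right)
  then have r: "(flat_fun n \<longlongrightarrow> 0) (at_right 0)"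
    by (rule tendsto_cong[THEN iffD1, rotated])
       (auto simp: flat_fun_def eventually_at_filter exp_minus field_simps)
  have l: "(flat_fun n \<longlongrightarrow> 0) (at_left 0)"
    by (rule tendsto_eventually) (auto simp: flat_fun_def eventually_at_filter)
  from l r show ?thesis by (simp add: filterlim_split_at)
qed

text \<open>The power of \<open>inverse t\<close> is carried along because it closes the family
  under differentiation; smoothness of all members then follows by one induction.\<close>

lemma flat_fun_has_derivative:
  "(flat_fun n has_real_derivative (flat_fun (n + 2) t - real n * flat_fun (n + 1) t)) (at t)"
proof -
  consider "t > 0" | "t < 0" | "t = 0" by linarith
  then show ?thesis
  proof cases
    case 1
    have "((\<lambda>t. exp (- inverse t) * inverse t ^ n) has_real_derivative
        (flat_fun (n + 2) t - real n * flat_fun (n + 1) t)) (at t)"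
    proof -
      have inv: "(inverse has_real_derivative - (inverse t * inverse t)) (at t)"
        using DERIV_inverse[of t UNIV] 1 by (simp add: power2_eq_square)
      show ?thesis
        by (rule DERIV_cong[OF DERIV_mult[OF DERIV_chain2[OF DERIV_exp DERIV_minus[OF inv]] DERIV_power[OF inv, of n]]])
           (use 1 in \<open>cases n; simp add: flat_fun_def ac_simps\<close>)
    qed
    then show ?thesis
      by (rule DERIV_cong_ev[THEN iffD1, OF refl _ refl, rotated])
         (use 1 eventually_nhds_in_open[of "{0<..}" t] in \<open>auto elim!: eventually_mono simp: flat_fun_def\<close>)
  next
    case 2
    have "((\<lambda>t. 0) has_real_derivative (flat_fun (n + 2) t - real n * flat_fun (n + 1) t)) (at t)"
      using 2 by (auto simp: flat_fun_def)
    then show ?thesis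
      by (rule DERIV_cong_ev[THEN iffD1, OF refl _ refl, rotated])
         (use 2 eventually_nhds_in_open[of "{..<0}" t] in \<open>auto elim!: eventually_mono simp: flat_fun_def\<close>)
  next
    \<comment> \<open>At the origin the difference quotient of \<open>flat_fun n\<close> is
      \<open>flat_fun (Suc n)\<close>, whose limit is already known to be zero.\<close>
    case 3
    have "((\<lambda>h. (flat_fun n (0 + h) - flat_fun n 0) / h) \<longlongrightarrow> 0) (at 0)"
      by (rule tendsto_cong[THEN iffD1, rotated, OF flat_fun_tendsto_0[of "Suc n"]])
         (auto simp: flat_fun_def field_simps eventually_at_filter)
    then show ?thesis
      using 3 by (simp add: DERIV_def flat_fun_def)
  qed
qed

lemma C_k_flat_fun: "C_k k (flat_fun n)"
proof (induction k arbitrary: n)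
  case 0
  then show ?case
    using DERIV_isCont[OF flat_fun_has_derivative] by (simp add: continuous_at_imp_continuous_on)
next
  case (Suc k)
  show ?case
    by (rule C_k_real_SucI[OF flat_fun_has_derivative]) (intro C_k_diff C_k_mult C_k_const Suc.IH)
qed

text \<open>The denominator never vanishes, since t and 1 - t cannot both be non-positive. The
  values 0 and 1 are attained exactly outside the unit interval, which later makes the layered
  gradients exact.\<close>

definition smooth_step :: "real \<Rightarrow> real" where
  "smooth_step t = flat_fun 0 t * inverse (flat_fun 0 t + flat_fun 0 (1 - t))"

lemma smooth_step_eq: "t \<le> 0 \<Longrightarrow> smooth_step t = 0" "t \<ge> 1 \<Longrightarrow> smooth_step t = 1"
  by (auto simp: smooth_step_def flat_fun_def)

lemma smooth_step_bounds: "0 \<le> smooth_step t" "smooth_step t \<le> 1"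
  by (auto simp: smooth_step_def flat_fun_def field_simps add_pos_nonneg)

lemma C_k_smooth_step: "C_k k smooth_step"
proof -
  have "C_k k (\<lambda>t. flat_fun 0 ((-1) * t + 1))"
    by (rule C_k_affine_compose[OF bounded_linear_mult_right C_k_flat_fun])
  then have refl: "C_k k (\<lambda>t. flat_fun 0 (1 - t))" by simp
  have nz: "flat_fun 0 t + flat_fun 0 (1 - t) \<noteq> 0" for t
    by (auto simp: flat_fun_def add_pos_pos less_imp_neq[symmetric])
  show ?thesis
    unfolding smooth_step_def[abs_def]
    by (rule C_k_mult[OF C_k_flat_fun C_k_inverse[OF nz C_k_add[OF C_k_flat_fun refl]]])
qed

section \<open>Quasiconvexity of affine functions of the matrix and its determinant\<close>

lemma integral_lborel_translate:
  fixes f :: "'a::euclidean_space \<Rightarrow> real"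
  assumes "f \<in> borel_measurable borel"
  shows "(LINT x|lborel. f (x + c)) = (LINT x|lborel. f x)"
proof -
  have "(LINT x|lborel. f x) = (LINT x|distr lborel borel ((+) c). f x)"
    by (simp add: lborel_distr_plus)
  also have "\<dots> = (LINT x|lborel. f (c + x))"
    by (rule integral_distr) (use assms in auto)
  finally show ?thesis by (simp add: add.commute)
qed

lemma integrable_compact_support:
  fixes f :: "'a::euclidean_space \<Rightarrow> real"
  assumes "continuous_on UNIV f" "compact S" "\<And>x. x \<notin> S \<Longrightarrow> f x = 0"
  shows "integrable lborel f"
proof -
  have "integrable lborel (\<lambda>x. indicat_real S x *\<^sub>R f x)"
    using assms(1,2) by (intro borel_integrable_compact) (auto intro: continuous_on_subset)
  moreover have "(\<lambda>x. indicat_real S x *\<^sub>R f x) = f"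
    using assms(3) by (auto simp: indicator_def fun_eq_iff)
  ultimately show ?thesis by simp
qed

text \<open>Dominated convergence: by the mean value theorem each quotient is a value of the
  directional derivative, hence bounded on a compact set, and it vanishes where short steps along
  \<open>v\<close> miss the support.\<close>

lemma difference_quotient_integral_tendsto:
  fixes u w :: "'a::euclidean_space \<Rightarrow> real"
  assumes der: "\<And>x. (u has_derivative u' x) (at x)"
    and cont: "continuous_on UNIV (\<lambda>x. u' x v)"
    and S: "compact S" "\<And>x. x \<notin> S \<Longrightarrow> u x = 0"
    and w: "continuous_on UNIV w"
  shows "(\<lambda>n. LINT x|lborel. w x * ((u (x + (1 / real (Suc n)) *\<^sub>R v) - u x) * real (Suc n)))
    \<longlonglongrightarrow> (LINT x|lborel. w x * u' x v)"
proof -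
  define q where "q n x = (u (x + (1 / real (Suc n)) *\<^sub>R v) - u x) * real (Suc n)" for n x
  \<comment> \<open>\<open>S'\<close> holds the points from which a step t v with t in [0, 1] can
    reach \<open>S\<close>; \<open>T\<close> holds all points met by such steps from
    \<open>S'\<close>, in particular the mean value points.\<close>
  define S' where "S' = (\<lambda>(x, t). x - t *\<^sub>R v) ` (S \<times> {0..1})"
  define T where "T = (\<lambda>(x, t). x + t *\<^sub>R v) ` (S' \<times> {0..1})"
  have S': "compact S'"
    unfolding S'_def case_prod_unfold
    by (intro compact_continuous_image compact_Times S compact_Icc continuous_intros)
  have T: "compact T"
    unfolding T_def case_prod_unfold
    by (intro compact_continuous_image compact_Times S' compact_Icc continuous_intros)
  have "compact ((\<lambda>x. u' x v) ` T)"
    using cont by (intro compact_continuous_image T) (auto intro: continuous_on_subset)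
  then obtain B where B: "\<And>x. x \<in> T \<Longrightarrow> \<bar>u' x v\<bar> \<le> B"
    using compact_imp_bounded by (fastforce simp: bounded_iff)
  have along: "((\<lambda>t. u (x + t *\<^sub>R v)) has_real_derivative u' (x + t *\<^sub>R v) v) (at t)" for x t
  proof -
    have "((\<lambda>t. x + t *\<^sub>R v) has_derivative (\<lambda>s. s *\<^sub>R v)) (at t)"
      by (auto intro!: derivative_eq_intros)
    from diff_chain_at[OF this der] have "((\<lambda>t. u (x + t *\<^sub>R v)) has_derivative (\<lambda>s. u' (x + t *\<^sub>R v) (s *\<^sub>R v))) (at t)"
      by (simp add: o_def)
    moreover have "(\<lambda>s. u' (x + t *\<^sub>R v) (s *\<^sub>R v)) = (*) (u' (x + t *\<^sub>R v) v)"
    proof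
      fix s
      show "u' (x + t *\<^sub>R v) (s *\<^sub>R v) = u' (x + t *\<^sub>R v) v * s"
        unfolding linear_cmul[OF has_derivative_linear[OF der]] by simp
    qed
    ultimately show ?thesis unfolding has_field_derivative_def by (simp only:)
  qed
  have u_cont: "continuous_on UNIV u"
    using der by (meson continuous_at_imp_continuous_on has_derivative_continuous)
  have q_cont: "continuous_on UNIV (q n)" for n
    unfolding q_def by (intro continuous_intros continuous_on_compose2[OF u_cont]) auto
  have q_bound: "\<bar>q n x\<bar> \<le> indicat_real S' x * B" for n x
  proof (cases "x \<in> S'")
    case True
    let ?h = "1 / real (Suc n)"
    obtain z where z: "0 < z" "z < ?h" "u (x + ?h *\<^sub>R v) - u (x + 0 *\<^sub>R v) = (?h - 0) * u' (x + z *\<^sub>R v) v"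
      using MVT2[of 0 ?h "\<lambda>t. u (x + t *\<^sub>R v)" "\<lambda>t. u' (x + t *\<^sub>R v) v"] along by auto
    then have "q n x = u' (x + z *\<^sub>R v) v" by (simp add: q_def)
    moreover have "z \<le> 1" using z(2) by (smt (verit) divide_le_eq_1 of_nat_0_less_iff of_nat_Suc of_nat_0_le_iff)
    then have "x + z *\<^sub>R v \<in> T"
      unfolding T_def using True z(1) by (force intro!: image_eqI[of _ _ "(x, z)"])
    ultimately show ?thesis using B True by simp
  next
    case False
    have "x + t *\<^sub>R v \<notin> S" if "t \<in> {0..1}" for t
    proof
      assume "x + t *\<^sub>R v \<in> S"
      then have "x \<in> S'" unfolding S'_def using that by (force intro!: image_eqI[of _ _ "(x + t *\<^sub>R v, t)"])
      with False show False ..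
    qed
    from this[of 0] this[of "1 / real (Suc n)"] have "u x = 0" "u (x + (1 / real (Suc n)) *\<^sub>R v) = 0"
      using S(2) by auto
    then show ?thesis using False by (simp add: q_def)
  qed
  have q_lim: "(\<lambda>n. q n x) \<longlonglongrightarrow> u' x v" for x
  proof -
    have "((\<lambda>h. (u (x + h *\<^sub>R v) - u x) / h) \<longlongrightarrow> u' x v) (at 0)"
      using along[of x 0] by (simp add: DERIV_def)
    moreover have "filterlim (\<lambda>n. 1 / real (Suc n)) (at 0) sequentially"
      unfolding filterlim_at using LIMSEQ_Suc[OF lim_1_over_n] by simp
    ultimately have "((\<lambda>n. (u (x + (1 / real (Suc n)) *\<^sub>R v) - u x) / (1 / real (Suc n))) \<longlonglongrightarrow> u' x v)"
      by (rule filterlim_compose)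
    then show ?thesis by (simp add: q_def)
  qed
  have "(\<lambda>n. LINT x|lborel. w x * q n x) \<longlonglongrightarrow> (LINT x|lborel. w x * u' x v)"
  proof (rule integral_dominated_convergence[where w = "\<lambda>x. indicat_real S' x *\<^sub>R (\<bar>w x\<bar> * B)"])
    show "(\<lambda>x. w x * u' x v) \<in> borel_measurable lborel"
      by (subst measurable_lborel2) (intro borel_measurable_continuous_onI continuous_intros w cont)
    show "(\<lambda>x. w x * q n x) \<in> borel_measurable lborel" for n
      by (subst measurable_lborel2) (intro borel_measurable_continuous_onI continuous_intros w q_cont)
    show "integrable lborel (\<lambda>x. indicat_real S' x *\<^sub>R (\<bar>w x\<bar> * B))"
      by (intro borel_integrable_compact S' continuous_intros continuous_on_subset[OF w]) auto
    show "AE x in lborel. (\<lambda>n. w x * q n x) \<longlonglongrightarrow> w x * u' x v"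
      by (intro AE_I2 tendsto_intros q_lim)
    show "AE x in lborel. norm (w x * q n x) \<le> indicat_real S' x *\<^sub>R (\<bar>w x\<bar> * B)" for n
      using mult_left_mono[OF q_bound, of "\<bar>w _\<bar>"] by (intro AE_I2) (simp add: abs_mult ac_simps)
  qed
  then show ?thesis by (simp add: q_def)
qed

text \<open>Translation invariance makes the integral of every difference quotient zero, and the
  limit inherits this.\<close>

lemma integral_derivative_compact_support:
  fixes u :: "'a::euclidean_space \<Rightarrow> real"
  assumes der: "\<And>x. (u has_derivative u' x) (at x)"
    and cont: "continuous_on UNIV (\<lambda>x. u' x v)"
    and S: "compact S" "\<And>x. x \<notin> S \<Longrightarrow> u x = 0"
  shows "(LINT x|lborel. u' x v) = 0"
proof -
  have u_cont: "continuous_on UNIV u"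
    using der by (meson continuous_at_imp_continuous_on has_derivative_continuous)
  have int: "integrable lborel u"
    by (rule integrable_compact_support[OF u_cont S])
  have int': "integrable lborel (\<lambda>x. u (x + c))" for c
  proof (rule integrable_compact_support)
    show "continuous_on UNIV (\<lambda>x. u (x + c))"
      by (intro continuous_on_compose2[OF u_cont] continuous_intros) auto
    show "compact ((\<lambda>x. x - c) ` S)"
      by (intro compact_continuous_image S continuous_intros)
    show "u (x + c) = 0" if "x \<notin> (\<lambda>x. x - c) ` S" for x
      using that S(2)[of "x + c"] by (force intro: image_eqI[of _ _ "x + c"])
  qed
  have "(LINT x|lborel. 1 * ((u (x + (1 / real (Suc n)) *\<^sub>R v) - u x) * real (Suc n))) = 0" for n
    using integral_lborel_translate[of u] borel_measurable_continuous_onI[OF u_cont] int int' by simp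
  moreover have "(\<lambda>n. LINT x|lborel. 1 * ((u (x + (1 / real (Suc n)) *\<^sub>R v) - u x) * real (Suc n)))
      \<longlonglongrightarrow> (LINT x|lborel. 1 * u' x v)"
    by (rule difference_quotient_integral_tendsto[OF der cont S continuous_on_const])
  ultimately have "(\<lambda>n. 0) \<longlonglongrightarrow> (LINT x|lborel. 1 * u' x v)" by (simp only:)
  then show ?thesis by (simp add: LIMSEQ_const_iff)
qed

text \<open>Integrating by parts against difference quotients of \<open>v\<close> avoids second derivatives.\<close>

lemma integral_derivative_product_swap:
  fixes u v :: "'a::euclidean_space \<Rightarrow> real"
  assumes u: "\<And>x. (u has_derivative u' x) (at x)" "\<And>a. continuous_on UNIV (\<lambda>x. u' x a)"
    and v: "\<And>x. (v has_derivative v' x) (at x)" "\<And>a. continuous_on UNIV (\<lambda>x. v' x a)"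
    and S: "compact S" "\<And>x. x \<notin> S \<Longrightarrow> u x = 0" "\<And>x. x \<notin> S \<Longrightarrow> v x = 0"
  shows "(LINT x|lborel. u' x a * v' x b) = (LINT x|lborel. u' x b * v' x a)"
proof -
  have u_cont: "continuous_on UNIV u" and v_cont: "continuous_on UNIV v"
    using u(1) v(1) by (meson continuous_at_imp_continuous_on has_derivative_continuous)+
  have u0: "u' x a = 0" if "x \<notin> S" for x
  proof -
    have "((\<lambda>_. 0) has_derivative u' x) (at x)"
      by (rule has_derivative_transform_within_open[OF u(1), where s = "- S"])
         (use that S compact_imp_closed in \<open>auto simp: open_Compl\<close>)
    then show ?thesis
      using has_derivative_unique[OF _ has_derivative_const] by metis
  qed
  \<comment> \<open>Integration by parts with a shifted factor; translating the integral moves the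
    shift from \<open>v\<close> to \<open>u\<close>.\<close>
  have parts: "(LINT x|lborel. u' x a * v (x + c)) = - (LINT x|lborel. u (x - c) * v' x a)" for c
  proof -
    have vc: "continuous_on UNIV (\<lambda>x. v (x + c))" "continuous_on UNIV (\<lambda>x. v' (x + c) a)"
      by (intro continuous_on_compose2[OF v_cont] continuous_on_compose2[OF v(2)] continuous_intros; auto)+
    have "((\<lambda>x. v (x + c)) has_derivative v' (x + c)) (at x)" for x
    proof -
      have "((\<lambda>x. x + c) has_derivative (\<lambda>h. h)) (at x)"
        by (auto intro!: derivative_eq_intros)
      from diff_chain_at[OF this v(1)] show ?thesis by (simp add: o_def)
    qed
    then have "(LINT x|lborel. u x * v' (x + c) a + u' x a * v (x + c)) = 0"
      by (intro integral_derivative_compact_support[where u = "\<lambda>x. u x * v (x + c)" and S = S and v = a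
            and u' = "\<lambda>x h. u x * v' (x + c) h + u' x h * v (x + c)"]
          has_derivative_mult u continuous_intros u_cont vc S) (simp_all add: S)
    moreover have "integrable lborel (\<lambda>x. u x * v' (x + c) a)"
      by (rule integrable_compact_support[OF continuous_on_mult[OF u_cont vc(2)] S(1)]) (simp add: S)
    moreover have "integrable lborel (\<lambda>x. u' x a * v (x + c))"
      by (rule integrable_compact_support[OF continuous_on_mult[OF u(2) vc(1)] S(1)]) (simp add: u0)
    ultimately have "(LINT x|lborel. u' x a * v (x + c)) = - (LINT x|lborel. u x * v' (x + c) a)"
      by simp
    also have "(LINT x|lborel. u x * v' (x + c) a) = (LINT x|lborel. u ((x + c) - c) * v' (x + c) a)"
      by simp
    also have "\<dots> = (LINT x|lborel. u (x - c) * v' x a)"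
      by (rule integral_lborel_translate)
         (intro borel_measurable_continuous_onI continuous_intros v continuous_on_compose2[OF u_cont]; auto)
    finally show ?thesis .
  qed
  have int1: "integrable lborel (\<lambda>x. u' x a * v (x + c))" for c
    by (rule integrable_compact_support[OF _ S(1)])
       (auto simp: u0 intro!: continuous_intros u continuous_on_compose2[OF v_cont])
  have int2: "integrable lborel (\<lambda>x. u (x - c) * v' x a)" for c
  proof (rule integrable_compact_support)
    show "continuous_on UNIV (\<lambda>x. u (x - c) * v' x a)"
      by (intro continuous_intros v continuous_on_compose2[OF u_cont]) auto
    show "compact ((\<lambda>x. x + c) ` S)"
      by (intro compact_continuous_image S continuous_intros)
    show "u (x - c) * v' x a = 0" if "x \<notin> (\<lambda>x. x + c) ` S" for x
      using that S(2)[of "x - c"] by (force intro: image_eqI[of _ _ "x - c"])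
  qed
  \<comment> \<open>A quotient of \<open>v\<close> along b becomes, up to sign, a quotient of
    \<open>u\<close> along -b. Only first derivatives occur, and the limits of the two sides are the
    two products to be compared.\<close>
  have "(LINT x|lborel. u' x a * ((v (x + (1 / real (Suc n)) *\<^sub>R b) - v x) * real (Suc n)))
      = - (LINT x|lborel. v' x a * ((u (x + (1 / real (Suc n)) *\<^sub>R (- b)) - u x) * real (Suc n)))" for n
  proof -
    let ?h = "(1 / real (Suc n)) *\<^sub>R b"
    have "(LINT x|lborel. u' x a * ((v (x + ?h) - v x) * real (Suc n)))
        = (LINT x|lborel. real (Suc n) * (u' x a * v (x + ?h) - u' x a * v (x + 0)))"
      by (simp add: algebra_simps)
    also have "\<dots> = real (Suc n) * ((LINT x|lborel. u' x a * v (x + ?h)) - (LINT x|lborel. u' x a * v (x + 0)))"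
      using int1[of ?h] int1[of 0] by simp
    also have "\<dots> = - (real (Suc n) * ((LINT x|lborel. u (x - ?h) * v' x a) - (LINT x|lborel. u (x - 0) * v' x a)))"
      unfolding parts by (simp add: algebra_simps)
    also have "\<dots> = - (LINT x|lborel. real (Suc n) * (u (x - ?h) * v' x a - u (x - 0) * v' x a))"
      using int2[of ?h] int2[of 0] by simp
    also have "\<dots> = - (LINT x|lborel. v' x a * ((u (x + (1 / real (Suc n)) *\<^sub>R (- b)) - u x) * real (Suc n)))"
      by (simp add: algebra_simps)
    finally show ?thesis .
  qed
  note eq = this
  have lim1: "(\<lambda>n. LINT x|lborel. u' x a * ((v (x + (1 / real (Suc n)) *\<^sub>R b) - v x) * real (Suc n)))
      \<longlonglongrightarrow> (LINT x|lborel. u' x a * v' x b)"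
    by (rule difference_quotient_integral_tendsto[OF v S(1,3) u(2)])
  have lim2: "(\<lambda>n. LINT x|lborel. v' x a * ((u (x + (1 / real (Suc n)) *\<^sub>R (- b)) - u x) * real (Suc n)))
      \<longlonglongrightarrow> (LINT x|lborel. v' x a * u' x (- b))"
    by (rule difference_quotient_integral_tendsto[OF u S(1,2) v(2)])
  have "(LINT x|lborel. u' x a * v' x b) = - (LINT x|lborel. v' x a * u' x (- b))"
    using lim1 unfolding eq by (rule LIMSEQ_unique[OF _ tendsto_minus[OF lim2]])
  moreover have "u' x (- b) = - u' x b" for x
    using linear_neg[OF has_derivative_linear[OF u(1)]] .
  ultimately show ?thesis by (simp add: mult.commute)
qed

section \<open>Symmetrised gradients of test functions\<close>

lemma sym_grad_entry:
  "sym_grad \<phi> x $ i $ j = (frechet_derivative \<phi> (at x) (axis j 1) $ i + frechet_derivative \<phi> (at x) (axis i 1) $ j) / 2"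
  by (simp add: sym_grad_def jacobian_def matrix_def transpose_def)

lemma sym_grad_sym [simp]: "sym_grad \<phi> x \<in> sym_matrices"
  by (simp add: sym_matrices_iff sym_grad_entry)

lemma continuous_on_frechet_derivative:
  assumes "\<And>k. C_k k \<phi>"
  shows "continuous_on UNIV (\<lambda>x. frechet_derivative \<phi> (at x) v)"
  using assms[of "Suc 0"] by simp

lemma continuous_on_matrix:
  fixes F :: "'a::topological_space \<Rightarrow> real^2^2"
  assumes "\<And>i j. continuous_on S (\<lambda>x. F x $ i $ j)"
  shows "continuous_on S F"
proof -
  have "continuous_on S (\<lambda>x. \<chi> i j. F x $ i $ j)"
    by (rule continuous_on_vec_lambda)+ (rule assms)
  then show ?thesis by simp
qed

lemma continuous_on_sym_grad:
  assumes "\<And>k. C_k k \<phi>"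
  shows "continuous_on UNIV (sym_grad \<phi>)"
proof (rule continuous_on_matrix)
  fix i j :: 2
  have "continuous_on UNIV (\<lambda>x. frechet_derivative \<phi> (at x) v $ i)" for v i
    using continuous_on_component[OF continuous_on_frechet_derivative[OF assms]] .
  then show "continuous_on UNIV (\<lambda>x. sym_grad \<phi> x $ i $ j)"
    unfolding sym_grad_entry by (intro continuous_on_divide continuous_on_add continuous_on_const) simp_all
qed

lemma frechet_derivative_outside_support:
  assumes "x \<notin> closure {x. \<phi> x \<noteq> 0}"
  shows "frechet_derivative \<phi> (at x) = (\<lambda>_. 0)"
proof -
  have "(\<phi> has_derivative (\<lambda>_. 0)) (at x)"
  proof (rule has_derivative_transform_within_open)
    show "((\<lambda>_. 0) has_derivative (\<lambda>_. 0)) (at x)" by (rule has_derivative_const)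
    show "open (- closure {x. \<phi> x \<noteq> 0})" "x \<in> - closure {x. \<phi> x \<noteq> 0}" using assms by auto
    show "0 = \<phi> y" if "y \<in> - closure {x. \<phi> x \<noteq> 0}" for y
      using that closure_subset[of "{x. \<phi> x \<noteq> 0}"] by auto
  qed
  then show ?thesis by (rule frechet_derivative_at[symmetric])
qed

lemma measurable_restrict_sym_compose:
  assumes "f \<in> borel_measurable (restrict_space borel sym_matrices)" "continuous_on UNIV F" "\<And>x. F x \<in> sym_matrices"
  shows "(\<lambda>x. f (F x)) \<in> borel_measurable borel"
proof -
  have "F \<in> borel \<rightarrow>\<^sub>M restrict_space borel sym_matrices"
    by (rule measurable_restrict_space2) (use assms(2,3) in \<open>auto intro: borel_measurable_continuous_onI\<close>)
  then show ?thesis using assms(1) by (rule measurable_compose)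
qed

lemma sym_quasiconvex_linear_minus_det:
  assumes "k \<ge> 0"
  shows "sym_quasiconvex (\<lambda>E. l \<bullet> E - k * det E)"
proof -
  define f where "f E = l \<bullet> E - k * det E" for E
  have f_cont: "continuous_on UNIV f"
    unfolding f_def det_2 by (intro continuous_intros)
  have "f \<in> borel_measurable (restrict_space borel sym_matrices)"
    using borel_measurable_continuous_onI[OF f_cont] by (rule measurable_restrict_space1)
  moreover have "locally_bounded_sym f"
    unfolding locally_bounded_sym_def
  proof (intro ballI exI conjI)
    fix A :: "real^2^2"
    have "compact (f ` cball A 1)"
      by (intro compact_continuous_image continuous_on_subset[OF f_cont]) auto
    then show "bounded (f ` (ball A 1 \<inter> sym_matrices))"
      by (rule bounded_subset[OF compact_imp_bounded]) auto
  qed simp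
  moreover have "ereal (f U) \<le> ereal (1 / measure lborel \<Omega> * (LINT x:\<Omega>|lborel. f (U + sym_grad \<phi> x)))"
    if \<Omega>: "open \<Omega>" "bounded \<Omega>" "\<Omega> \<noteq> {}" and U: "U \<in> sym_matrices" and \<phi>: "\<phi> \<in> test_functions \<Omega>" for \<Omega> U \<phi>
  proof -
    define K where "K = closure {x. \<phi> x \<noteq> 0}"
    have C: "\<And>k. C_k k \<phi>" and K: "compact K" "K \<subseteq> \<Omega>"
      using \<phi> by (auto simp: test_functions_def K_def)
    define D where "D i j x = frechet_derivative \<phi> (at x) (axis j 1) $ i" for i j x
    have D0: "D i j x = 0" if "x \<notin> K" for i j x
      using that by (simp add: D_def K_def frechet_derivative_outside_support)
    have \<phi>0: "\<phi> x $ i = 0" if "x \<notin> K" for i x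
    proof -
      have "x \<notin> {x. \<phi> x \<noteq> 0}"
        using that closure_subset[of "{x. \<phi> x \<noteq> 0}"] unfolding K_def by (simp only: subset_iff) metis
      then show ?thesis by simp
    qed
    have Dc: "continuous_on UNIV (D i j)" for i j
      unfolding D_def by (intro continuous_intros continuous_on_frechet_derivative C)
    have der: "((\<lambda>x. \<phi> x $ i) has_derivative (\<lambda>h. frechet_derivative \<phi> (at x) h $ i)) (at x)" for i x
      by (rule bounded_linear.has_derivative[OF bounded_linear_vec_nth C_k_SucD1[OF C[of "Suc 0"]]])
    have derc: "continuous_on UNIV (\<lambda>x. frechet_derivative \<phi> (at x) a $ i)" for i a
      by (intro continuous_intros continuous_on_frechet_derivative C)
    have int_D: "(LINT x|lborel. D i j x) = 0" for i j
      unfolding D_def by (rule integral_derivative_compact_support[OF der derc K(1) \<phi>0])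
    have swap: "(LINT x|lborel. D 1 1 x * D 2 2 x) = (LINT x|lborel. D 1 2 x * D 2 1 x)"
      unfolding D_def by (rule integral_derivative_product_swap[OF der derc der derc K(1) \<phi>0 \<phi>0])
    have iD: "integrable lborel (D i j)" for i j
      by (rule integrable_compact_support[OF Dc K(1) D0])
    have iDD: "integrable lborel (\<lambda>x. D i j x * D i' j' x)" for i j i' j'
      by (rule integrable_compact_support[OF continuous_on_mult[OF Dc Dc] K(1)]) (simp add: D0)
    \<comment> \<open>\<open>L\<close> collects the terms of zero mean: those linear in the
      derivatives, and -k times the Jacobian determinant. Apart from the constant, what remains of f
      is a square with the non-negative factor k.\<close>
    define L where "L x = (l$1$1 - k * U$2$2) * D 1 1 x + (l$2$2 - k * U$1$1) * D 2 2 x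
       + ((l$1$2 + l$2$1) / 2 + k * U$1$2) * (D 1 2 x + D 2 1 x)
       - k * (D 1 1 x * D 2 2 x - D 1 2 x * D 2 1 x)" for x
    have L_int: "integrable lborel L" and L0: "(LINT x|lborel. L x) = 0"
      unfolding L_def using iD iDD int_D swap by simp_all
    have LK: "L x = 0" if "x \<notin> K" for x using that by (simp add: L_def D0)
    have f_eq: "f (U + sym_grad \<phi> x) = f U + L x + k * ((D 1 2 x - D 2 1 x) / 2)\<^sup>2" for x
    proof -
      have "f (U + E) = f U + (l \<bullet> E - k * (U$1$1 * E$2$2 + U$2$2 * E$1$1 - 2 * U$1$2 * E$1$2 + det E))"
        if "E \<in> sym_matrices" for E
        using U that by (simp add: f_def det_2 inner_add_right sym_matrices_iff algebra_simps)
      note this[OF sym_grad_sym]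
      moreover have "l \<bullet> sym_grad \<phi> x - k * (U$1$1 * sym_grad \<phi> x$2$2 + U$2$2 * sym_grad \<phi> x$1$1
          - 2 * U$1$2 * sym_grad \<phi> x$1$2 + det (sym_grad \<phi> x)) = L x + k * ((D 1 2 x - D 2 1 x) / 2)\<^sup>2"
        by (simp add: L_def inner_vec_def sum_2 det_2 sym_grad_entry D_def[symmetric] power2_eq_square
            add_divide_distrib diff_divide_distrib algebra_simps)
      ultimately show ?thesis by (simp only: sym_grad_sym add.assoc)
    qed
    have em: "emeasure lborel \<Omega> < \<infinity>" using emeasure_bounded_finite[OF \<Omega>(2)] .
    have mpos: "measure lborel \<Omega> > 0"
    proof -
      have "\<Omega> \<in> lmeasurable" using lmeasurable_open[OF \<Omega>(2,1)] .
      moreover have "measure lebesgue \<Omega> = measure lborel \<Omega>"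
        using \<Omega>(1) by (intro measure_completion) auto
      ultimately have "measure lborel \<Omega> \<noteq> 0"
        using open_not_negligible[OF \<Omega>(1,3)] by (simp add: negligible_iff_measure)
      then show ?thesis using measure_nonneg[of lborel \<Omega>] by linarith
    qed
    have indU: "integrable lborel (\<lambda>x. indicat_real \<Omega> x *\<^sub>R f U)"
      using em \<Omega>(1) by (intro integrable_scaleR_left integrable_real_indicator) auto
    have indL: "(\<lambda>x. indicat_real \<Omega> x *\<^sub>R L x) = L"
      using K(2) LK by (auto simp: fun_eq_iff indicator_def)
    \<comment> \<open>\<open>L\<close> vanishes off \<open>K\<close>, which lies in \<Omega>, so
      integrating it over \<Omega> is the same as integrating it over the plane.\<close>
    have low_eq: "(\<lambda>x. indicat_real \<Omega> x *\<^sub>R (f U + L x)) = (\<lambda>x. indicat_real \<Omega> x *\<^sub>R f U + L x)"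
      using K(2) LK by (auto simp: fun_eq_iff indicator_def)
    have low: "integrable lborel (\<lambda>x. indicat_real \<Omega> x *\<^sub>R (f U + L x))"
      unfolding low_eq by (rule Bochner_Integration.integrable_add[OF indU L_int])
    have low_int: "(LINT x|lborel. indicat_real \<Omega> x *\<^sub>R (f U + L x)) = measure lborel \<Omega> * f U"
      unfolding low_eq Bochner_Integration.integral_add[OF indU L_int] L0
      by simp
    have high: "integrable lborel (\<lambda>x. indicat_real \<Omega> x *\<^sub>R f (U + sym_grad \<phi> x))"
    proof -
      have "integrable lborel (\<lambda>x. L x + k * ((D 1 2 x - D 2 1 x) / 2)\<^sup>2)"
        by (rule integrable_compact_support[OF _ K(1)])
           (auto simp: LK D0 L_def intro!: continuous_intros Dc)
      note Bochner_Integration.integrable_add[OF indU this]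
      moreover have "(\<lambda>x. indicat_real \<Omega> x *\<^sub>R f U + (L x + k * ((D 1 2 x - D 2 1 x) / 2)\<^sup>2))
          = (\<lambda>x. indicat_real \<Omega> x *\<^sub>R f (U + sym_grad \<phi> x))"
      proof
        fix x
        show "indicat_real \<Omega> x *\<^sub>R f U + (L x + k * ((D 1 2 x - D 2 1 x) / 2)\<^sup>2)
          = indicat_real \<Omega> x *\<^sub>R f (U + sym_grad \<phi> x)"
        proof (cases "x \<in> \<Omega>")
          case False
          then have "x \<notin> K" using K(2) by blast
          with False show ?thesis by (simp add: LK D0)
        qed (simp add: f_eq)
      qed
      ultimately show ?thesis by (simp only:)
    qed
    have "measure lborel \<Omega> * f U \<le> (LINT x:\<Omega>|lborel. f (U + sym_grad \<phi> x))"
      unfolding set_lebesgue_integral_def low_int[symmetric]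
      using assms by (intro integral_mono low high) (auto simp: f_eq indicator_def)
    then show ?thesis using mpos by (simp add: field_simps)
  qed
  ultimately show ?thesis
    unfolding sym_quasiconvex_def f_def[symmetric] by (blast intro: INF_greatest)
qed

section \<open>Weights from a separating hyperplane\<close>

lemma sym_qc_hull_weights:
  fixes \<U> :: "(real^2^2) set"
  assumes fin: "finite \<U>" and A: "A \<in> sym_qc_hull \<U>"
  obtains w where "\<And>M. M \<in> \<U> \<Longrightarrow> w M \<ge> 0" "sum w \<U> = 1" "(\<Sum>M\<in>\<U>. w M *\<^sub>R M) = A"
    "(\<Sum>M\<in>\<U>. w M * det M) \<le> det A"
proof -
  define h :: "real^2^2 \<Rightarrow> (real^2^2) \<times> real" where "h M = (M, - det M)" for M
  \<comment> \<open>The added downward ray has two effects: membership of \<open>h A\<close> asserts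
    only an inequality between determinants, and a functional bounded below on \<open>K\<close> must
    have a non-positive last component. Those are the functionals whose negative, composed with
    \<open>h\<close>, is known to be quasiconvex.\<close>
  define K where "K = {x + y | x y. x \<in> convex hull (h ` \<U>) \<and> y \<in> {0} \<times> {..0}}"
  have "h A \<in> K"
  proof (rule ccontr)
    assume notin: "h A \<notin> K"
    have K_eq: "K = (\<Union>x\<in>convex hull (h ` \<U>). \<Union>y\<in>{0} \<times> {..0}. {x + y})"
      unfolding K_def by blast
    have "convex K"
      unfolding K_eq
      by (intro convex_sums convex_convex_hull convex_Times convex_singleton convex_real_interval)
    moreover have "closed K"
      unfolding K_eq
      by (intro compact_closed_sums compact_convex_hull finite_imp_compact finite_imageI fin
          closed_Times closed_atMost) auto
    ultimately obtain a b where ab: "a \<bullet> h A < b" "\<And>x. x \<in> K \<Longrightarrow> b < a \<bullet> x"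
      using separating_hyperplane_closed_point[OF _ _ notin] by metis
    obtain l k where a: "a = (l, k)" by (cases a)
    have inK: "(M, - det M - t) \<in> K" if "M \<in> \<U>" "t \<ge> 0" for M t
    proof -
      have "(M, - det M - t) = h M + (0, - t)" by (simp add: h_def)
      moreover have "h M \<in> convex hull (h ` \<U>)" using that by (simp add: hull_inc)
      ultimately show ?thesis unfolding K_def using that by fastforce
    qed
    have f_less: "- l \<bullet> M - (- k) * det M < - b" if "M \<in> \<U>" for M
      using ab(2)[OF inK[OF that, of 0]] by (simp add: a)
    \<comment> \<open>Over no wells the supremum is \<open>-\<infinity>\<close>, below every real
      value; the zero function exhibits this.\<close>
    have "\<U> \<noteq> {}"
    proof
      assume "\<U> = {}"
      have "sym_quasiconvex (\<lambda>E. 0 \<bullet> E - 0 * det E)"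
        by (rule sym_quasiconvex_linear_minus_det) simp
      with A \<open>\<U> = {}\<close> show False by (auto simp: sym_qc_hull_def bot_ereal_def)
    qed
    then obtain M where M: "M \<in> \<U>" by blast
    have "k \<le> 0"
    proof (rule ccontr)
      assume "\<not> k \<le> 0"
      \<comment> \<open>If k were positive, this is far enough down the ray to bring the functional
        to at most b.\<close>
      define t where "t = \<bar>l \<bullet> M - k * det M - b\<bar> / k"
      have "t \<ge> 0" "k * t = \<bar>l \<bullet> M - k * det M - b\<bar>" using \<open>\<not> k \<le> 0\<close> by (auto simp: t_def)
      with ab(2)[OF inK[OF M, of t]] show False by (simp add: a algebra_simps)
    qed
    then have "sym_quasiconvex (\<lambda>E. - l \<bullet> E - (- k) * det E)"
      by (intro sym_quasiconvex_linear_minus_det) simp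
    then have "ereal (- l \<bullet> A - (- k) * det A) \<le> (SUP M\<in>\<U>. ereal (- l \<bullet> M - (- k) * det M))"
      using A unfolding sym_qc_hull_def by blast
    also have "\<dots> \<le> ereal (- b)"
      by (intro SUP_least) (use f_less in \<open>simp add: less_imp_le\<close>)
    finally show False using ab(1) by (simp add: a h_def)
  qed
  then obtain x t where x: "x \<in> convex hull (h ` \<U>)" and t: "t \<le> 0" and hA: "h A = x + (0, t)"
    unfolding K_def by auto
  obtain u where u: "\<And>y. y \<in> h ` \<U> \<Longrightarrow> u y \<ge> 0" "sum u (h ` \<U>) = 1" "(\<Sum>y\<in>h ` \<U>. u y *\<^sub>R y) = x"
    using x unfolding convex_hull_finite[OF finite_imageI[OF fin]] by blast
  have inj: "inj_on h \<U>" by (auto simp: inj_on_def h_def)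
  have sx: "(\<Sum>M\<in>\<U>. u (h M) *\<^sub>R h M) = x" "(\<Sum>M\<in>\<U>. u (h M)) = 1"
    using u(2,3) inj by (simp_all add: sum.reindex)
  have "fst x = (\<Sum>M\<in>\<U>. u (h M) *\<^sub>R M)" "snd x = (\<Sum>M\<in>\<U>. u (h M) * - det M)"
    unfolding sx(1)[symmetric] by (simp_all add: fst_sum snd_sum h_def)
  moreover have "A = fst x" "- det A = snd x + t"
    using hA by (auto simp: h_def prod_eq_iff)
  ultimately show ?thesis
    using that[of "\<lambda>M. u (h M)"] u(1) sx(2) t by (simp add: sum_negf)
qed

section \<open>Convexity along compatible segments\<close>

definition rotated_box :: "real^2 \<Rightarrow> real \<Rightarrow> real \<Rightarrow> real \<Rightarrow> real \<Rightarrow> (real^2) set" where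
  "rotated_box m a b c d = {x. a < m \<bullet> x \<and> m \<bullet> x < b \<and> c < perp m \<bullet> x \<and> perp m \<bullet> x < d}"

text \<open>Inverse of x -> (m . x, perp m . x). Since \<open>m\<close> comes from a factorisation
  it is not normalised, hence the divisions by \<open>m \<bullet> m\<close>.\<close>

definition frame_map :: "real^2 \<Rightarrow> real^2 \<Rightarrow> real^2" where
  "frame_map m y = (y $ 1 / (m \<bullet> m)) *\<^sub>R m + (y $ 2 / (m \<bullet> m)) *\<^sub>R perp m"

lemma perp_simps: "perp m $ 1 = - (m $ 2)" "perp m $ 2 = m $ 1"
  by (simp_all add: perp_def)

lemma perp_inner [simp]: "m \<bullet> perp m = 0" "perp m \<bullet> m = 0" "perp m \<bullet> perp m = m \<bullet> m"
  by (simp_all add: inner_vec_def sum_2 perp_simps)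

lemma linear_frame_map: "linear (frame_map m)"
  by (rule linearI) (simp_all add: frame_map_def add_divide_distrib algebra_simps)

lemma frame_map_inner:
  assumes "m \<noteq> 0"
  shows "m \<bullet> frame_map m y = y $ 1" "perp m \<bullet> frame_map m y = y $ 2"
  using assms by (simp_all add: frame_map_def inner_add_right)

lemma frame_map_inverse:
  assumes "m \<noteq> 0"
  shows "frame_map m (vector [m \<bullet> x, perp m \<bullet> x]) = x"
proof -
  have "m \<bullet> m \<noteq> 0" using assms by simp
  moreover have "(m \<bullet> x) *\<^sub>R m + (perp m \<bullet> x) *\<^sub>R perp m = (m \<bullet> m) *\<^sub>R x"
    by (simp add: vec_eq_iff forall_2 inner_vec_def sum_2 perp_simps algebra_simps)
  moreover have "frame_map m (vector [m \<bullet> x, perp m \<bullet> x])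
      = (1 / (m \<bullet> m)) *\<^sub>R ((m \<bullet> x) *\<^sub>R m + (perp m \<bullet> x) *\<^sub>R perp m)"
    by (simp add: frame_map_def algebra_simps)
  ultimately show ?thesis by simp
qed

lemma rotated_box_eq_image:
  assumes "m \<noteq> 0"
  shows "rotated_box m a b c d = frame_map m ` box (vector [a, c]) (vector [b, d])"
proof (intro set_eqI iffI)
  fix x assume "x \<in> rotated_box m a b c d"
  then have "vector [m \<bullet> x, perp m \<bullet> x] \<in> box (vector [a, c]) (vector [b, d] :: real^2)"
    by (simp add: rotated_box_def mem_box_cart forall_2)
  then show "x \<in> frame_map m ` box (vector [a, c]) (vector [b, d])"
    by (rule image_eqI[rotated]) (rule frame_map_inverse[OF assms, symmetric])
qed (auto simp: rotated_box_def mem_box_cart forall_2 frame_map_inner[OF assms])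

lemma open_rotated_box: "open (rotated_box m a b c d)"
  unfolding rotated_box_def
  by (intro open_Collect_conj open_Collect_less continuous_on_inner continuous_on_const continuous_on_id)

text \<open>The factor \<kappa> stays unspecified: only quotients of such measures matter, and there
  it cancels.\<close>

lemma rotated_box_measure:
  assumes "m \<noteq> 0"
  obtains \<kappa> where "\<kappa> > 0"
    "\<And>a b c d. a \<le> b \<Longrightarrow> c \<le> d \<Longrightarrow> measure lborel (rotated_box m a b c d) = \<kappa> * ((b - a) * (d - c))"
proof (rule that)
  have "inj (frame_map m)"
  proof (rule injI)
    fix x y assume "frame_map m x = frame_map m y"
    then have "x $ 1 = y $ 1" "x $ 2 = y $ 2"
      using frame_map_inner[OF assms, of x] frame_map_inner[OF assms, of y] by simp_all
    then show "x = y" by (simp add: vec_eq_iff forall_2)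
  qed
  then show "\<bar>det (matrix (frame_map m))\<bar> > 0"
    using det_nz_iff_inj[OF linear_frame_map] by simp
  fix a b c d :: real assume le: "a \<le> b" "c \<le> d"
  let ?B = "box (vector [a, c]) (vector [b, d]) :: (real^2) set"
  have "measure lborel (rotated_box m a b c d) = measure lebesgue (rotated_box m a b c d)"
    using open_rotated_box by (intro measure_completion[symmetric]) auto
  also have "\<dots> = \<bar>det (matrix (frame_map m))\<bar> * measure lebesgue ?B"
    unfolding rotated_box_eq_image[OF assms]
    by (rule measure_linear_image[OF linear_frame_map]) simp
  also have "measure lebesgue ?B = measure lborel ?B"
    by (intro measure_completion) auto
  also have "\<dots> = measure lborel (cbox (vector [a, c]) (vector [b, d]) :: (real^2) set)"
    by (simp add: measure_lborel_box_eq measure_lborel_cbox_eq)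
  also have "\<dots> = (b - a) * (d - c)"
    using le by (subst content_cbox_cart) (auto simp: UNIV_2 interval_ne_empty_cart forall_2)
  finally show "measure lborel (rotated_box m a b c d) = \<bar>det (matrix (frame_map m))\<bar> * ((b - a) * (d - c))" .
qed

lemma bounded_rotated_box:
  assumes "m \<noteq> 0" shows "bounded (rotated_box m a b c d)"
  unfolding rotated_box_eq_image[OF assms]
  by (intro bounded_linear_image bounded_box linear_conv_bounded_linear[THEN iffD1] linear_frame_map)

lemma connected_rotated_box:
  assumes "m \<noteq> 0" shows "connected (rotated_box m a b c d)"
  unfolding rotated_box_eq_image[OF assms]
  by (intro convex_connected convex_linear_image linear_frame_map convex_box)

text \<open>The symmetric matrices form a closed subspace, so its closed balls are compact and are
  covered by finitely many neighbourhoods on which f is bounded.\<close>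

lemma locally_bounded_sym_bounded:
  assumes "locally_bounded_sym f"
  obtains M where "\<And>X. X \<in> sym_matrices \<Longrightarrow> norm X \<le> R \<Longrightarrow> \<bar>f X\<bar> \<le> M"
proof -
  have "closed (sym_matrices :: (real^2^2) set)"
  proof -
    have eq: "sym_matrices = {M :: real^2^2. M $ 1 $ 2 = M $ 2 $ 1}"
      by (auto simp: sym_matrices_iff)
    show ?thesis
      unfolding eq by (intro closed_Collect_eq continuous_on_component continuous_on_id)
  qed
  then have cpt: "compact (cball 0 R \<inter> sym_matrices :: (real^2^2) set)"
    by (rule compact_Int_closed[OF compact_cball])
  obtain r where r: "\<And>A. A \<in> sym_matrices \<Longrightarrow> r A > 0 \<and> bounded (f ` (ball A (r A) \<inter> sym_matrices))"
    using assms unfolding locally_bounded_sym_def by metis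
  have cover: "cball 0 R \<inter> sym_matrices \<subseteq> (\<Union>A\<in>cball 0 R \<inter> sym_matrices. ball A (r A))"
    using r by (meson IntD2 UN_I centre_in_ball subsetI)
  obtain F where F: "F \<subseteq> cball 0 R \<inter> sym_matrices" "finite F"
      "cball 0 R \<inter> sym_matrices \<subseteq> (\<Union>A\<in>F. ball A (r A))"
    by (rule compactE_image[OF cpt _ cover]) auto
  have "bounded (\<Union>A\<in>F. f ` (ball A (r A) \<inter> sym_matrices))"
    using F r by (intro bounded_UN) auto
  then obtain M where M: "\<And>y. y \<in> (\<Union>A\<in>F. f ` (ball A (r A) \<inter> sym_matrices)) \<Longrightarrow> \<bar>y\<bar> \<le> M"
    unfolding bounded_iff by auto
  show ?thesis
  proof (rule that[of M])
    fix X assume "X \<in> sym_matrices" "norm X \<le> R"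
    then have "X \<in> cball 0 R \<inter> sym_matrices" by simp
    with F(3) obtain A where "A \<in> F" "X \<in> ball A (r A) \<inter> sym_matrices" by blast
    then show "\<bar>f X\<bar> \<le> M" by (intro M) blast
  qed
qed

section \<open>Profile functions of the layered test field\<close>

lemma smooth_step_derivative:
  obtains s' C where "\<And>t. (smooth_step has_real_derivative s' t) (at t)"
    "\<And>t. t < 0 \<Longrightarrow> s' t = 0" "\<And>t. t > 1 \<Longrightarrow> s' t = 0" "\<And>t. \<bar>s' t\<bar> \<le> C"
proof -
  obtain s' where s': "\<And>t. (smooth_step has_real_derivative s' t) (at t)" and c: "C_k 0 s'"
    using C_k_real_SucE[OF C_k_smooth_step] by metis
  have lo: "s' t = 0" if "t < 0" for t
  proof (rule DERIV_unique[OF s'])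
    show "(smooth_step has_real_derivative 0) (at t)"
      by (rule has_field_derivative_transform_within_open[where f = "\<lambda>_. 0" and S = "{..<0}"])
         (use that in \<open>auto simp: smooth_step_eq\<close>)
  qed
  have hi: "s' t = 0" if "t > 1" for t
  proof (rule DERIV_unique[OF s'])
    show "(smooth_step has_real_derivative 0) (at t)"
      by (rule has_field_derivative_transform_within_open[where f = "\<lambda>_. 1" and S = "{1<..}"])
         (use that in \<open>auto simp: smooth_step_eq\<close>)
  qed
  have "compact (s' ` {0..1})"
    using c by (intro compact_continuous_image) (auto intro: continuous_on_subset)
  then obtain C where C: "\<And>t. t \<in> {0..1} \<Longrightarrow> \<bar>s' t\<bar> \<le> C"
    using compact_imp_bounded by (fastforce simp: bounded_iff)
  have "\<bar>s' t\<bar> \<le> C" for t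
    using C[of t] C[of 0] lo[of t] hi[of t] by (cases "t \<in> {0..1}") auto
  with s' lo hi show ?thesis by (rule that)
qed

lemma tensor_entry: "tensor u v $ i $ j = u $ i * v $ j"
  by (simp add: tensor_def)

text \<open>The first term is a multiple of the prescribed difference of the two matrices and is all
  that survives where the cutoff is 1 with zero slope; the second term is the cost of cutting
  off.\<close>

lemma sym_grad_layered:
  fixes T p :: "real \<Rightarrow> real"
  assumes "(T has_real_derivative T') (at (m \<bullet> x))" "(p has_real_derivative p') (at (perp m \<bullet> x))"
  shows "sym_grad (\<lambda>x. (T (m \<bullet> x) * p (perp m \<bullet> x)) *\<^sub>R c) x =
    (T' * p (perp m \<bullet> x)) *\<^sub>R ((1/2) *\<^sub>R (tensor c m + tensor m c)) +
    (T (m \<bullet> x) * p') *\<^sub>R ((1/2) *\<^sub>R (tensor c (perp m) + tensor (perp m) c))"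
proof -
  define F where "F h = (T' * (m \<bullet> h) * p (perp m \<bullet> x) + T (m \<bullet> x) * (p' * (perp m \<bullet> h))) *\<^sub>R c" for h
  have inner: "((\<lambda>x. v \<bullet> x) has_derivative (\<lambda>h. v \<bullet> h)) (at x)" for v :: "real^2"
    by (intro bounded_linear_imp_has_derivative bounded_linear_inner_right)
  have "((\<lambda>x. T (m \<bullet> x)) has_derivative (\<lambda>h. T' * (m \<bullet> h))) (at x)"
    using diff_chain_at[OF inner assms(1)[unfolded has_field_derivative_def]] by (simp add: o_def)
  moreover have "((\<lambda>x. p (perp m \<bullet> x)) has_derivative (\<lambda>h. p' * (perp m \<bullet> h))) (at x)"
    using diff_chain_at[OF inner assms(2)[unfolded has_field_derivative_def]] by (simp add: o_def)
  ultimately have "((\<lambda>x. (T (m \<bullet> x) * p (perp m \<bullet> x)) *\<^sub>R c) has_derivative F) (at x)"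
    unfolding F_def by (auto intro!: derivative_eq_intros simp: algebra_simps)
  then have "frechet_derivative (\<lambda>x. (T (m \<bullet> x) * p (perp m \<bullet> x)) *\<^sub>R c) (at x) = F"
    by (rule frechet_derivative_at[symmetric])
  then show ?thesis
    by (simp add: vec_eq_iff sym_grad_entry F_def tensor_entry inner_axis field_simps)
qed

lemma C_k_inner_compose: "C_k k T \<Longrightarrow> C_k k (\<lambda>x :: 'a::real_inner. T (m \<bullet> x))"
  using C_k_affine_compose[OF bounded_linear_inner_right, of k T m 0] by simp

lemma C_k_scale_compose: "C_k k T \<Longrightarrow> C_k k (\<lambda>t :: real. T (r * t + d))"
  by (rule C_k_affine_compose[OF bounded_linear_mult_right])

text \<open>Smoothed positive part that equals t exactly, without an offset, beyond 1.\<close>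

definition ramp :: "real \<Rightarrow> real" where
  "ramp t = t * smooth_step t"

text \<open>The slope changes by 1 - l, -1 and l near 0, \<open>l * L\<close> and L. These changes
  and their first moments sum to zero, so the profile has slopes 1 - l and -l and returns exactly to
  zero.\<close>

definition tent :: "real \<Rightarrow> real \<Rightarrow> real \<Rightarrow> real" where
  "tent l L t = (1 - l) * ramp t - ramp (t - l * L) + l * ramp (t - L)"

text \<open>The cutoff falls over a length L because the tent has height of order L: height times
  slope stays bounded. A side of length L^2 makes these transition zones a vanishing share.\<close>

definition plateau :: "real \<Rightarrow> real \<Rightarrow> real" where
  "plateau L y = smooth_step (y / L) * smooth_step (L - y / L)"

lemma ramp_eq: "t \<le> 0 \<Longrightarrow> ramp t = 0" "t \<ge> 1 \<Longrightarrow> ramp t = t"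
  by (simp_all add: ramp_def smooth_step_eq)

lemma abs_ramp_le: "\<bar>ramp t\<bar> \<le> \<bar>t\<bar>"
  using mult_left_mono[OF smooth_step_bounds(2), of "\<bar>t\<bar>" t] smooth_step_bounds(1)[of t]
  by (simp add: ramp_def abs_mult)

lemma C_k_ramp: "C_k k ramp"
  unfolding ramp_def[abs_def] by (rule C_k_mult[OF C_k_bounded_linear[OF bounded_linear_ident] C_k_smooth_step])

lemma C_k_tent: "C_k k (tent l L)"
proof -
  have sh: "C_k k (\<lambda>t. ramp (t - d))" for d
    using C_k_scale_compose[OF C_k_ramp, of k 1 "- d"] by simp
  show ?thesis
    unfolding tent_def[abs_def]
    by (rule C_k_add[OF C_k_diff[OF C_k_mult[OF C_k_const C_k_ramp] sh] C_k_mult[OF C_k_const sh]])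
qed

lemma C_k_plateau: "C_k k (plateau L)"
proof -
  have "C_k k (\<lambda>y. smooth_step (y / L))" "C_k k (\<lambda>y. smooth_step (L - y / L))"
    using C_k_scale_compose[OF C_k_smooth_step, of k "1 / L" 0]
      C_k_scale_compose[OF C_k_smooth_step, of k "- 1 / L" L] by simp_all
  then show ?thesis
    unfolding plateau_def[abs_def] by (rule C_k_mult)
qed

lemma ramp_derivative:
  obtains r' C where "\<And>t. (ramp has_real_derivative r' t) (at t)"
    "\<And>t. t < 0 \<Longrightarrow> r' t = 0" "\<And>t. t > 1 \<Longrightarrow> r' t = 1" "\<And>t. \<bar>r' t\<bar> \<le> C"
proof -
  obtain s' C where s': "\<And>t. (smooth_step has_real_derivative s' t) (at t)"
    "\<And>t. t < 0 \<Longrightarrow> s' t = 0" "\<And>t. t > 1 \<Longrightarrow> s' t = 0" "\<And>t. \<bar>s' t\<bar> \<le> C"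
    using smooth_step_derivative by metis
  show ?thesis
  proof (rule that)
    show "(ramp has_real_derivative smooth_step t + t * s' t) (at t)" for t
      unfolding ramp_def[abs_def] by (auto intro!: derivative_eq_intros s')
    show "smooth_step t + t * s' t = 0" if "t < 0" for t
      using that by (simp add: smooth_step_eq s')
    show "smooth_step t + t * s' t = 1" if "t > 1" for t
      using that by (simp add: smooth_step_eq s')
    show "\<bar>smooth_step t + t * s' t\<bar> \<le> 1 + C" for t
    proof (cases "0 \<le> t \<and> t \<le> 1")
      case True
      have "\<bar>t * s' t\<bar> \<le> 1 * C"
        unfolding abs_mult using True s'(4) by (intro mult_mono) auto
      then show ?thesis using smooth_step_bounds[of t] by linarith
    next
      case False
      then show ?thesis
        using smooth_step_bounds[of t] s'(2,3)[of t] s'(4)[of t] by (auto simp: not_le)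
    qed
  qed
qed

text \<open>The bound on the slope must not depend on L, which tends to infinity later; three ramps
  give the factor 3.\<close>

lemma tent_derivative:
  obtains C where "\<forall>l\<in>{0..1}. \<forall>L\<ge>0. \<exists>T'. (\<forall>t. (tent l L has_real_derivative T' t) (at t)) \<and>
    (\<forall>t. 1 < t \<longrightarrow> t < l * L \<longrightarrow> T' t = 1 - l) \<and> (\<forall>t. l * L + 1 < t \<longrightarrow> t < L \<longrightarrow> T' t = - l) \<and>
    (\<forall>t. \<bar>T' t\<bar> \<le> C)"
proof -
  obtain r' C where r': "\<And>t. (ramp has_real_derivative r' t) (at t)"
    "\<And>t. t < 0 \<Longrightarrow> r' t = 0" "\<And>t. t > 1 \<Longrightarrow> r' t = 1" "\<And>t. \<bar>r' t\<bar> \<le> C"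
    using ramp_derivative by metis
  show ?thesis
  proof (rule that[of "3 * C"], intro ballI exI conjI allI impI)
    fix l L :: real assume l: "l \<in> {0..1}" and "L \<ge> 0"
    then have lL: "l * L \<le> L" "0 \<le> l * L" using mult_right_mono[of l 1 L] by auto
    let ?T' = "\<lambda>t. (1 - l) * r' t - r' (t - l * L) + l * r' (t - L)"
    have sh: "((\<lambda>t. ramp (t - d)) has_real_derivative r' (t - d)) (at t)" for t d
      using DERIV_shift[of ramp "r' (t - d)" t "- d"] r'(1) by simp
    show "(tent l L has_real_derivative ?T' t) (at t)" for t
      unfolding tent_def[abs_def] by (intro DERIV_add DERIV_diff DERIV_cmult r' sh)
    show "?T' t = 1 - l" if "1 < t" "t < l * L" for t
      using that lL by (simp add: r')
    show "?T' t = - l" if "l * L + 1 < t" "t < L" for t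
      using that lL by (simp add: r')
    show "\<bar>?T' t\<bar> \<le> 3 * C" for t
    proof -
      have C: "\<bar>k * r' u\<bar> \<le> C" if "k \<in> {0..1}" for k u
        using mult_mono[of "\<bar>k\<bar>" 1 "\<bar>r' u\<bar>" C] that r'(4)[of u] by (simp add: abs_mult)
      show ?thesis
        using C[of "1 - l" t] C[of 1 "t - l * L"] C[of l "t - L"] l by auto
    qed
  qed
qed

lemma tent_outside:
  assumes "l \<in> {0..1}" "L \<ge> 0" "t \<le> 0 \<or> t \<ge> L + 1" shows "tent l L t = 0"
proof -
  have lL: "l * L \<le> L" "0 \<le> l * L" using assms mult_right_mono[of l 1 L] by auto
  then show ?thesis
    using assms(2,3) by (auto simp: tent_def ramp_eq algebra_simps)
qed

lemma abs_tent_le: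
  assumes "l \<in> {0..1}" "L \<ge> 0" "-1 \<le> t" "t \<le> L + 2" shows "\<bar>tent l L t\<bar> \<le> 3 * (L + 2)"
proof -
  have lL: "l * L \<le> L" "0 \<le> l * L" using assms mult_right_mono[of l 1 L] by auto
  have C: "\<bar>k * ramp u\<bar> \<le> L + 2" if "k \<in> {0..1}" "\<bar>u\<bar> \<le> L + 2" for k u
    using mult_mono[of "\<bar>k\<bar>" 1 "\<bar>ramp u\<bar>" "L + 2"] that abs_ramp_le[of u] by (simp add: abs_mult)
  show ?thesis
  proof -
    have "\<bar>t\<bar> \<le> L + 2" "\<bar>t - l * L\<bar> \<le> L + 2" "\<bar>t - L\<bar> \<le> L + 2"
      using lL assms(2-4) by linarith+
    then have "\<bar>(1 - l) * ramp t\<bar> \<le> L + 2" "\<bar>1 * ramp (t - l * L)\<bar> \<le> L + 2" "\<bar>l * ramp (t - L)\<bar> \<le> L + 2"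
      using assms(1) by (intro C; simp)+
    moreover have "\<bar>x - y + z\<bar> \<le> 3 * K" if "\<bar>x\<bar> \<le> K" "\<bar>1 * y\<bar> \<le> K" "\<bar>z\<bar> \<le> K" for x y z K :: real
      using that by linarith
    ultimately show ?thesis unfolding tent_def by blast
  qed
qed

lemma plateau_derivative:
  obtains C where "\<forall>L\<ge>1. \<exists>p'. (\<forall>y. (plateau L has_real_derivative p' y) (at y)) \<and>
    (\<forall>y. L < y \<longrightarrow> y < L\<^sup>2 - L \<longrightarrow> p' y = 0) \<and> (\<forall>y. \<bar>p' y\<bar> \<le> C / L)"
proof -
  obtain s' C where s': "\<And>t. (smooth_step has_real_derivative s' t) (at t)"
    "\<And>t. t < 0 \<Longrightarrow> s' t = 0" "\<And>t. t > 1 \<Longrightarrow> s' t = 0" "\<And>t. \<bar>s' t\<bar> \<le> C"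
    using smooth_step_derivative by metis
  show ?thesis
  proof (rule that[of "2 * C"], intro exI conjI allI impI)
    fix L :: real assume L: "L \<ge> 1"
    let ?d = "\<lambda>y. s' (y / L) * smooth_step (L - y / L) - smooth_step (y / L) * s' (L - y / L)"
    show "(plateau L has_real_derivative ?d y / L) (at y)" for y
    proof -
      have "((\<lambda>y. smooth_step (y / L)) has_real_derivative s' (y / L) * (1 / L)) (at y)"
        by (rule DERIV_chain2[OF s'(1)]) (use L in \<open>auto intro!: derivative_eq_intros\<close>)
      moreover have "((\<lambda>y. smooth_step (L - y / L)) has_real_derivative s' (L - y / L) * (- 1 / L)) (at y)"
        by (rule DERIV_chain2[OF s'(1)]) (use L in \<open>auto intro!: derivative_eq_intros\<close>)
      ultimately show ?thesis
        unfolding plateau_def[abs_def] by (rule DERIV_cong[OF DERIV_mult]) (simp add: diff_divide_distrib mult.commute)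
    qed
    show "?d y / L = 0" if "L < y" "y < L\<^sup>2 - L" for y
    proof -
      have "y / L > 1" "L - y / L > 1" using that L by (auto simp: field_simps power2_eq_square)
      then show ?thesis by (simp add: s')
    qed
    show "\<bar>?d y / L\<bar> \<le> 2 * C / L" for y
    proof -
      have C: "\<bar>s' u * smooth_step v\<bar> \<le> C" for u v
        using mult_mono[of "\<bar>s' u\<bar>" C "\<bar>smooth_step v\<bar>" 1] s'(4)[of u] smooth_step_bounds[of v]
        by (simp add: abs_mult)
      have "\<bar>?d y\<bar> \<le> 2 * C"
        using C[of "y / L" "L - y / L"] C[of "L - y / L" "y / L"] by (simp add: mult.commute)
      then show ?thesis using L by (simp add: divide_right_mono)
    qed
  qed
qed

lemma plateau_outside:
  assumes "L \<ge> 1" "y \<le> 0 \<or> y \<ge> L\<^sup>2" shows "plateau L y = 0"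
proof -
  have "y / L \<le> 0 \<or> L - y / L \<le> 0"
    using assms by (auto simp: field_simps power2_eq_square)
  then show ?thesis by (auto simp: plateau_def smooth_step_eq)
qed

lemma plateau_eq_1:
  assumes "L \<ge> 1" "L \<le> y" "y \<le> L\<^sup>2 - L" shows "plateau L y = 1"
proof -
  have "y / L \<ge> 1" "L - y / L \<ge> 1" using assms by (auto simp: field_simps power2_eq_square)
  then show ?thesis by (simp add: plateau_def smooth_step_eq)
qed

lemma abs_plateau_le: "\<bar>plateau L y\<bar> \<le> 1"
  using mult_mono[of "smooth_step (y / L)" 1 "smooth_step (L - y / L)" 1] smooth_step_bounds
  by (simp add: plateau_def abs_mult)

text \<open>\<open>M\<close> bounds f on all values taken by the shifted gradient, uniformly in L.
  Replacing f by \<open>M\<close> outside two good rectangles turns quasiconvexity into this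
  estimate; the quotients are the area fractions of these rectangles.\<close>

lemma laminate_inequality:
  assumes f: "sym_quasiconvex f" and A: "A \<in> sym_matrices" and B: "B \<in> sym_matrices"
    and AB: "A - B = (1/2) *\<^sub>R (tensor c m + tensor m c)" "m \<noteq> 0"
    and l: "l \<in> {0..1}"
  obtains M where "\<forall>L\<ge>3. l * L \<ge> 1 \<longrightarrow> (1 - l) * L \<ge> 1 \<longrightarrow>
    f (l *\<^sub>R A + (1 - l) *\<^sub>R B) \<le>
      ((l * L - 1) * (L\<^sup>2 - 2 * L)) / ((L + 3) * (L\<^sup>2 + 2)) * (f A - M)
    + (((1 - l) * L - 1) * (L\<^sup>2 - 2 * L)) / ((L + 3) * (L\<^sup>2 + 2)) * (f B - M) + M"
proof -
  define U where "U = l *\<^sub>R A + (1 - l) *\<^sub>R B"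
  have U: "U \<in> sym_matrices" using A B by (simp add: U_def)
  define E where "E = (1/2) *\<^sub>R (tensor c (perp m) + tensor (perp m) c)"
  obtain C1 where C1: "\<forall>l\<in>{0..1}. \<forall>L\<ge>0. \<exists>T'. (\<forall>t. (tent l L has_real_derivative T' t) (at t)) \<and>
    (\<forall>t. 1 < t \<longrightarrow> t < l * L \<longrightarrow> T' t = 1 - l) \<and> (\<forall>t. l * L + 1 < t \<longrightarrow> t < L \<longrightarrow> T' t = - l) \<and>
    (\<forall>t. \<bar>T' t\<bar> \<le> C1)"
    by (rule tent_derivative)
  obtain C2 where C2: "\<forall>L\<ge>1. \<exists>p'. (\<forall>y. (plateau L has_real_derivative p' y) (at y)) \<and>
    (\<forall>y. L < y \<longrightarrow> y < L\<^sup>2 - L \<longrightarrow> p' y = 0) \<and> (\<forall>y. \<bar>p' y\<bar> \<le> C2 / L)"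
    by (rule plateau_derivative)
  \<comment> \<open>The tent slope meets a cutoff of at most 1, and the tent height
    \<open>3 * (L + 2)\<close> meets the cutoff slope \<open>C2 / L\<close>; since
    \<open>L + 2 \<le> 3 * L\<close>, the second product is at most \<open>9 * C2\<close>.\<close>
  define R where "R = norm U + C1 * norm (A - B) + 9 * C2 * norm E"
  obtain M where M: "\<And>X. X \<in> sym_matrices \<Longrightarrow> norm X \<le> R \<Longrightarrow> \<bar>f X\<bar> \<le> M"
    using locally_bounded_sym_bounded f unfolding sym_quasiconvex_def by metis
  obtain \<kappa> where \<kappa>: "\<kappa> > 0"
    "\<And>a b c d. a \<le> b \<Longrightarrow> c \<le> d \<Longrightarrow> measure lborel (rotated_box m a b c d) = \<kappa> * ((b - a) * (d - c))"
    using rotated_box_measure[OF AB(2)] by metis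
  show ?thesis
  proof (rule that[of M], intro allI impI)
    fix L :: real assume L: "L \<ge> 3" "l * L \<ge> 1" "(1 - l) * L \<ge> 1"
    obtain T' where T': "\<And>t. (tent l L has_real_derivative T' t) (at t)"
      "\<And>t. 1 < t \<Longrightarrow> t < l * L \<Longrightarrow> T' t = 1 - l" "\<And>t. l * L + 1 < t \<Longrightarrow> t < L \<Longrightarrow> T' t = - l"
      "\<And>t. \<bar>T' t\<bar> \<le> C1"
      using C1[rule_format, OF l, of L] L by auto
    obtain p' where p': "\<And>y. (plateau L has_real_derivative p' y) (at y)"
      "\<And>y. L < y \<Longrightarrow> y < L\<^sup>2 - L \<Longrightarrow> p' y = 0" "\<And>y. \<bar>p' y\<bar> \<le> C2 / L"
      using C2[rule_format, of L] L by auto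
    define \<phi> where "\<phi> = (\<lambda>x. (tent l L (m \<bullet> x) * plateau L (perp m \<bullet> x)) *\<^sub>R c)"
    \<comment> \<open>A margin of 1 around the closed rectangle containing the support keeps the
      support inside the open set.\<close>
    define \<Omega> where "\<Omega> = rotated_box m (-1) (L + 2) (-1) (L\<^sup>2 + 1)"
    \<comment> \<open>The unit offsets skip the zones where a ramp still bends; here and on
      \<open>GB\<close> the slopes are exactly 1 - l and -l and the cutoff is exactly 1.\<close>
    define GA where "GA = rotated_box m 1 (l * L) L (L\<^sup>2 - L)"
    define GB where "GB = rotated_box m (l * L + 1) L L (L\<^sup>2 - L)"
    have grad: "sym_grad \<phi> x = (T' (m \<bullet> x) * plateau L (perp m \<bullet> x)) *\<^sub>R (A - B)
        + (tent l L (m \<bullet> x) * p' (perp m \<bullet> x)) *\<^sub>R E" for x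
      unfolding \<phi>_def AB E_def by (rule sym_grad_layered[OF T'(1) p'(1)])
    have C: "C_k k \<phi>" for k
      unfolding \<phi>_def
      by (rule C_k_scaleR[OF C_k_mult[OF C_k_inner_compose[OF C_k_tent] C_k_inner_compose[OF C_k_plateau]] C_k_const])
    have \<Omega>: "open \<Omega>" "connected \<Omega>" "bounded \<Omega>"
      unfolding \<Omega>_def using AB(2) by (simp_all add: open_rotated_box connected_rotated_box bounded_rotated_box)
    have LL: "L\<^sup>2 \<ge> 3 * L" "l * L \<le> L - 1" using L by (simp_all add: power2_eq_square algebra_simps)
    have m\<Omega>: "measure lborel \<Omega> = \<kappa> * ((L + 3) * (L\<^sup>2 + 2))"
      unfolding \<Omega>_def using L LL by (subst \<kappa>(2)) (auto simp: add.commute)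
    have mA: "measure lborel GA = \<kappa> * ((l * L - 1) * (L\<^sup>2 - 2 * L))"
      unfolding GA_def using L LL by (subst \<kappa>(2)) (auto simp: algebra_simps)
    have mB: "measure lborel GB = \<kappa> * (((1 - l) * L - 1) * (L\<^sup>2 - 2 * L))"
      unfolding GB_def using L LL by (subst \<kappa>(2)) (auto simp: algebra_simps)
    have pos: "(L + 3) * (L\<^sup>2 + 2) > 0" using L LL by (intro mult_pos_pos) auto
    then have m\<Omega>_pos: "measure lborel \<Omega> > 0" using \<kappa>(1) by (simp add: m\<Omega>)
    then have \<Omega>_ne: "\<Omega> \<noteq> {}" by auto
    have supp: "closure {x. \<phi> x \<noteq> 0} \<subseteq> {x. 0 \<le> m \<bullet> x \<and> m \<bullet> x \<le> L + 1 \<and> 0 \<le> perp m \<bullet> x \<and> perp m \<bullet> x \<le> L\<^sup>2}"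
    proof (rule closure_minimal)
      show "{x. \<phi> x \<noteq> 0} \<subseteq> {x. 0 \<le> m \<bullet> x \<and> m \<bullet> x \<le> L + 1 \<and> 0 \<le> perp m \<bullet> x \<and> perp m \<bullet> x \<le> L\<^sup>2}"
      proof
        fix x assume "x \<in> {x. \<phi> x \<noteq> 0}"
        then have "tent l L (m \<bullet> x) \<noteq> 0" "plateau L (perp m \<bullet> x) \<noteq> 0" by (auto simp: \<phi>_def)
        then show "x \<in> {x. 0 \<le> m \<bullet> x \<and> m \<bullet> x \<le> L + 1 \<and> 0 \<le> perp m \<bullet> x \<and> perp m \<bullet> x \<le> L\<^sup>2}"
          using tent_outside[OF l, of L "m \<bullet> x"] plateau_outside[of L "perp m \<bullet> x"] L by force
      qed
      show "closed {x. 0 \<le> m \<bullet> x \<and> m \<bullet> x \<le> L + 1 \<and> 0 \<le> perp m \<bullet> x \<and> perp m \<bullet> x \<le> L\<^sup>2}"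
        by (intro closed_Collect_conj closed_Collect_le continuous_on_inner continuous_on_const continuous_on_id)
    qed
    also have sub: "\<dots> \<subseteq> \<Omega>" by (auto simp: \<Omega>_def rotated_box_def)
    finally have "closure {x. \<phi> x \<noteq> 0} \<subseteq> \<Omega>" .
    then have test: "\<phi> \<in> test_functions \<Omega>"
      using C bounded_subset[OF \<Omega>(3)] by (auto simp: test_functions_def compact_eq_bounded_closed)
    have "ereal (f U) \<le> (INF \<phi>\<in>test_functions \<Omega>. ereal (1 / measure lborel \<Omega> * (LINT x:\<Omega>|lborel. f (U + sym_grad \<phi> x))))"
      using f \<Omega> \<Omega>_ne U unfolding sym_quasiconvex_def by blast
    also have "\<dots> \<le> ereal (1 / measure lborel \<Omega> * (LINT x:\<Omega>|lborel. f (U + sym_grad \<phi> x)))"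
      by (rule INF_lower[OF test])
    finally have key: "f U * measure lborel \<Omega> \<le> (LINT x:\<Omega>|lborel. f (U + sym_grad \<phi> x))"
      using m\<Omega>_pos by (simp add: field_simps)
    have onA: "U + sym_grad \<phi> x = A" if "x \<in> GA" for x
    proof -
      have "plateau L (perp m \<bullet> x) = 1" using that L by (intro plateau_eq_1) (auto simp: GA_def rotated_box_def)
      moreover have "T' (m \<bullet> x) = 1 - l" "p' (perp m \<bullet> x) = 0"
        using that by (auto simp: GA_def rotated_box_def T' p')
      ultimately have "sym_grad \<phi> x = (1 - l) *\<^sub>R (A - B)" unfolding grad by simp
      then show ?thesis by (simp add: U_def algebra_simps)
    qed
    have onB: "U + sym_grad \<phi> x = B" if "x \<in> GB" for x
    proof -
      have "plateau L (perp m \<bullet> x) = 1" using that L by (intro plateau_eq_1) (auto simp: GB_def rotated_box_def)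
      moreover have "T' (m \<bullet> x) = - l" "p' (perp m \<bullet> x) = 0"
        using that by (auto simp: GB_def rotated_box_def T' p')
      ultimately have "sym_grad \<phi> x = (- l) *\<^sub>R (A - B)" unfolding grad by simp
      then show ?thesis by (simp add: U_def algebra_simps)
    qed
    have bound: "\<bar>f (U + sym_grad \<phi> x)\<bar> \<le> M" if "x \<in> \<Omega>" for x
    proof (rule M)
      show "U + sym_grad \<phi> x \<in> sym_matrices" using U by simp
      have "\<bar>T' (m \<bullet> x) * plateau L (perp m \<bullet> x)\<bar> \<le> C1 * 1"
        unfolding abs_mult using T'(4)[of 0] by (intro mult_mono T' abs_plateau_le) auto
      moreover have "\<bar>tent l L (m \<bullet> x) * p' (perp m \<bullet> x)\<bar> \<le> (3 * (L + 2)) * (C2 / L)"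
        unfolding abs_mult using that L by (intro mult_mono p' abs_tent_le l) (auto simp: \<Omega>_def rotated_box_def)
      moreover have "(3 * (L + 2)) * (C2 / L) \<le> 9 * C2"
      proof -
        have "C2 / L \<ge> 0" using p'(3)[of 0] by linarith
        then have "C2 \<ge> 0" using L by (simp add: zero_le_divide_iff)
        then have "C2 * (L + 2) \<le> C2 * (3 * L)" using L by (intro mult_left_mono) auto
        then show ?thesis using L by (simp add: field_simps)
      qed
      ultimately have "norm (sym_grad \<phi> x) \<le> C1 * norm (A - B) + 9 * C2 * norm E"
        unfolding grad by (intro norm_triangle_le add_mono) (auto intro!: mult_right_mono)
      then show "norm (U + sym_grad \<phi> x) \<le> R"
        using norm_triangle_ineq[of U "sym_grad \<phi> x"] by (simp add: R_def)
    qed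
    have sub: "GA \<subseteq> \<Omega>" "GB \<subseteq> \<Omega>" and disj: "GA \<inter> GB = {}"
      using L LL by (auto simp: GA_def GB_def \<Omega>_def rotated_box_def)
    have fin: "emeasure lborel \<Omega> < \<infinity>" "emeasure lborel GA < \<infinity>" "emeasure lborel GB < \<infinity>"
      using emeasure_bounded_finite bounded_rotated_box[OF AB(2)] unfolding \<Omega>_def GA_def GB_def by blast+
    have meas: "\<Omega> \<in> sets lborel" "GA \<in> sets lborel" "GB \<in> sets lborel"
      unfolding \<Omega>_def GA_def GB_def using open_rotated_box by auto
    have ind: "integrable lborel (indicat_real \<Omega>)" "integrable lborel (indicat_real GA)" "integrable lborel (indicat_real GB)"
      using fin meas by (intro integrable_real_indicator; simp)+
    \<comment> \<open>A step function above the integrand; both rectangles lie in \<Omega>, so the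
      constant \<open>M\<close> of the last term is taken off again on them.\<close>
    define g where "g x = indicat_real GA x * (f A - M) + indicat_real GB x * (f B - M) + indicat_real \<Omega> x * M" for x
    have "integrable lborel g"
      unfolding g_def using ind by simp
    have meas_f: "(\<lambda>x. indicat_real \<Omega> x *\<^sub>R f (U + sym_grad \<phi> x)) \<in> borel_measurable lborel"
    proof -
      have "(\<lambda>x. f (U + sym_grad \<phi> x)) \<in> borel_measurable borel"
        by (rule measurable_restrict_sym_compose)
           (use f U C in \<open>auto simp: sym_quasiconvex_def intro!: continuous_on_add continuous_on_sym_grad\<close>)
      then show ?thesis using meas by simp
    qed
    have "integrable lborel (\<lambda>x. indicat_real \<Omega> x *\<^sub>R f (U + sym_grad \<phi> x))"
      by (rule Bochner_Integration.integrable_bound[OF integrable_mult_left[OF ind(1), of M] meas_f])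
         (use bound in \<open>force intro!: AE_I2 simp: indicator_def\<close>)
    then have "(LINT x:\<Omega>|lborel. f (U + sym_grad \<phi> x)) \<le> (LINT x|lborel. g x)"
      unfolding set_lebesgue_integral_def
    proof (rule integral_mono)
      fix x
      show "indicat_real \<Omega> x *\<^sub>R f (U + sym_grad \<phi> x) \<le> g x"
      proof (cases "x \<in> GA \<or> x \<in> GB")
        case True
        then show ?thesis using sub disj onA[of x] onB[of x] by (auto simp: g_def indicator_def)
      next
        case False
        then show ?thesis using bound[of x] by (auto simp: g_def indicator_def)
      qed
    qed fact
    also have "\<dots> = measure lborel GA * (f A - M) + measure lborel GB * (f B - M) + measure lborel \<Omega> * M"
      unfolding g_def using ind meas by simp
    finally have "f U * measure lborel \<Omega> \<le> measure lborel GA * (f A - M) + measure lborel GB * (f B - M) + measure lborel \<Omega> * M"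
      using key by linarith
    then have "f U \<le> (measure lborel GA * (f A - M) + measure lborel GB * (f B - M) + measure lborel \<Omega> * M) / measure lborel \<Omega>"
      using m\<Omega>_pos by (simp only: pos_le_divide_eq)
    also have "\<dots> = measure lborel GA / measure lborel \<Omega> * (f A - M) + measure lborel GB / measure lborel \<Omega> * (f B - M) + M"
      using m\<Omega>_pos by (simp add: add_divide_distrib)
    finally have "f U \<le> measure lborel GA / measure lborel \<Omega> * (f A - M) + measure lborel GB / measure lborel \<Omega> * (f B - M) + M" .
    then show "f (l *\<^sub>R A + (1 - l) *\<^sub>R B) \<le>
        ((l * L - 1) * (L\<^sup>2 - 2 * L)) / ((L + 3) * (L\<^sup>2 + 2)) * (f A - M)
      + (((1 - l) * L - 1) * (L\<^sup>2 - 2 * L)) / ((L + 3) * (L\<^sup>2 + 2)) * (f B - M) + M"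
      unfolding m\<Omega> mA mB U_def[symmetric] using \<kappa>(1) by simp
  qed
qed

text \<open>As L grows the area fractions tend to l and 1 - l, and \<open>M\<close> cancels in the
  limit.\<close>

lemma sym_quasiconvex_compatible_convex:
  assumes f: "sym_quasiconvex f" and A: "A \<in> sym_matrices" and B: "B \<in> sym_matrices"
    and comp: "compatible A B" and l: "l \<in> {0..1}"
  shows "f (l *\<^sub>R A + (1 - l) *\<^sub>R B) \<le> l * f A + (1 - l) * f B"
proof -
  obtain c m where AB: "A - B = (1/2) *\<^sub>R (tensor c m + tensor m c)"
    using compatible_rank_one_decomposition[OF A B comp] .
  consider "l = 0" | "l = 1" | "A = B" | "A \<noteq> B" "0 < l" "l < 1" using l by fastforce
  then show ?thesis
  proof cases
    case 3
    then show ?thesis by (simp add: scaleR_left_distrib[symmetric] algebra_simps)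
  next
    case 4
    have "m \<noteq> 0"
    proof
      assume "m = 0"
      then have "A - B = 0" using AB by (simp add: vec_eq_iff tensor_def)
      with 4(1) show False by simp
    qed
    obtain M where M: "\<forall>L\<ge>3. l * L \<ge> 1 \<longrightarrow> (1 - l) * L \<ge> 1 \<longrightarrow>
    f (l *\<^sub>R A + (1 - l) *\<^sub>R B) \<le>
      ((l * L - 1) * (L\<^sup>2 - 2 * L)) / ((L + 3) * (L\<^sup>2 + 2)) * (f A - M)
    + (((1 - l) * L - 1) * (L\<^sup>2 - 2 * L)) / ((L + 3) * (L\<^sup>2 + 2)) * (f B - M) + M"
      by (rule laminate_inequality[OF f A B AB \<open>m \<noteq> 0\<close> l])
    have lim: "((\<lambda>L. (k * L - 1) * (L\<^sup>2 - 2 * L) / ((L + 3) * (L\<^sup>2 + 2))) \<longlongrightarrow> k) at_top" if "k > 0" for k :: real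
      using that by real_asymp
    have "((\<lambda>L. ((l * L - 1) * (L\<^sup>2 - 2 * L)) / ((L + 3) * (L\<^sup>2 + 2)) * (f A - M)
      + (((1 - l) * L - 1) * (L\<^sup>2 - 2 * L)) / ((L + 3) * (L\<^sup>2 + 2)) * (f B - M) + M) \<longlongrightarrow>
        l * (f A - M) + (1 - l) * (f B - M) + M) at_top"
      using 4 by (intro tendsto_add tendsto_mult tendsto_const lim) auto
    then have "f (l *\<^sub>R A + (1 - l) *\<^sub>R B) \<le> l * (f A - M) + (1 - l) * (f B - M) + M"
    proof (rule tendsto_lowerbound)
      have "eventually (\<lambda>L. L \<ge> 3 \<and> L \<ge> 1 / l \<and> L \<ge> 1 / (1 - l)) at_top"
        by (intro eventually_conj eventually_ge_at_top)
      then show "\<forall>\<^sub>F L in at_top. f (l *\<^sub>R A + (1 - l) *\<^sub>R B) \<le> ((l * L - 1) * (L\<^sup>2 - 2 * L)) / ((L + 3) * (L\<^sup>2 + 2)) * (f A - M)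
      + (((1 - l) * L - 1) * (L\<^sup>2 - 2 * L)) / ((L + 3) * (L\<^sup>2 + 2)) * (f B - M) + M"
        by eventually_elim (rule M[rule_format], use 4 in \<open>auto simp: field_simps\<close>)
    qed simp
    then show ?thesis by (simp add: algebra_simps)
  qed simp_all
qed

lemma sym_lam_hull_subset_qc_hull:
  assumes "\<U> \<subseteq> sym_matrices"
  shows "sym_lam_hull \<U> \<subseteq> sym_qc_hull \<U>"
proof
  fix X assume X: "X \<in> sym_lam_hull \<U>"
  have sym: "lam_iter i \<U> \<subseteq> sym_matrices" for i
    using sym_lam_hull_subset_sym[OF assms] by (auto simp: sym_lam_hull_def)
  have "ereal (f X) \<le> (SUP B\<in>\<U>. ereal (f B))" if f: "sym_quasiconvex f" and "X \<in> lam_iter i \<U>" for f X i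
    using that(2)
  proof (induction i arbitrary: X)
    case 0
    then show ?case by (auto intro: SUP_upper)
  next
    case (Suc i)
    from Suc.prems obtain l A B where X: "X = l *\<^sub>R A + (1 - l) *\<^sub>R B" and l: "l \<in> {0..1}"
      and AB: "A \<in> lam_iter i \<U>" "B \<in> lam_iter i \<U>" "compatible A B"
      unfolding lam_iter.simps by blast
    have "f X \<le> l * f A + (1 - l) * f B"
      unfolding X using AB sym by (intro sym_quasiconvex_compatible_convex f l) auto
    also have "\<dots> \<le> l * max (f A) (f B) + (1 - l) * max (f A) (f B)"
      using l by (intro add_mono mult_left_mono) auto
    also have "\<dots> = max (f A) (f B)" by (simp add: algebra_simps)
    finally have "ereal (f X) \<le> max (ereal (f A)) (ereal (f B))"
      by (simp add: max_def split: if_splits)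
    also have "\<dots> \<le> (SUP B\<in>\<U>. ereal (f B))"
      using Suc.IH AB by simp
    finally show ?case .
  qed
  moreover have "X \<in> sym_matrices" using X sym_lam_hull_subset_sym[OF assms] by blast
  ultimately show "X \<in> sym_qc_hull \<U>"
    using X by (auto simp: sym_qc_hull_def sym_lam_hull_def)
qed

section \<open>Wells in the plane\<close>

text \<open>What is left of the quasiconvex hull after the separation argument: a statement about
  weights and determinants only.\<close>

definition mixtures_in_lam_hull :: "(real^2^2) set \<Rightarrow> bool" where
  "mixtures_in_lam_hull \<U> \<longleftrightarrow> (\<forall>w. (\<forall>M\<in>\<U>. w M \<ge> 0) \<longrightarrow> sum w \<U> = 1 \<longrightarrow>
     (\<Sum>M\<in>\<U>. w M * det M) \<le> det (\<Sum>M\<in>\<U>. w M *\<^sub>R M) \<longrightarrow> (\<Sum>M\<in>\<U>. w M *\<^sub>R M) \<in> sym_lam_hull \<U>)"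

text \<open>Polarisation of a quadratic form; in particular det is affine along segments between
  rank-one compatible matrices.\<close>

lemma det_convex_combination:
  fixes A B :: "real^2^2"
  assumes "u + v = 1"
  shows "det (u *\<^sub>R A + v *\<^sub>R B) = u * det A + v * det B - u * v * det (A - B)"
proof -
  have "v = 1 - u" using assms by simp
  show ?thesis unfolding \<open>v = 1 - u\<close> by (simp add: det_2 algebra_simps)
qed

lemma det_scaleR_2: "det (r *\<^sub>R (A::real^2^2)) = r\<^sup>2 * det A"
  by (simp add: det_2 power2_eq_square algebra_simps)

lemma det_minus_commute: "det (A - B) = det (B - (A::real^2^2))"
  by (simp add: det_2 algebra_simps)

text \<open>Since det is affine between the two matrices, the barycentre inherits the determinant
  sum. The weights are not normalised, so that a pair of total weight zero is covered as
  well.\<close>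

lemma rank_one_pair_barycentre:
  assumes V: "V1 \<in> sym_lam_hull \<U>" "V2 \<in> sym_lam_hull \<U>" and U: "\<U> \<subseteq> sym_matrices"
    and d: "det (V1 - V2) = 0" and v: "v1 \<ge> 0" "v2 \<ge> 0" "v1 + v2 = r"
  obtains B where "B \<in> sym_lam_hull \<U>" "v1 *\<^sub>R V1 + v2 *\<^sub>R V2 = r *\<^sub>R B" "v1 * det V1 + v2 * det V2 = r * det B"
proof (cases "r = 0")
  \<comment> \<open>With total weight zero any point of the hull serves as barycentre.\<close>
  case True
  then have "v1 = 0" "v2 = 0" using v by auto
  then show ?thesis using that[of V1] V True by simp
next
  case False
  define B where "B = (v1 / r) *\<^sub>R V1 + (v2 / r) *\<^sub>R V2"
  have r: "r > 0" using v False by linarith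
  then have one: "v1 / r + v2 / r = 1" using v(3) by (simp add: add_divide_distrib[symmetric])
  have "V1 \<in> sym_matrices" "V2 \<in> sym_matrices" using V sym_lam_hull_subset_sym[OF U] by auto
  then have "compatible V1 V2" using d by (simp add: compatible_iff_det)
  then have "B \<in> sym_lam_hull \<U>"
    unfolding B_def using V v r one by (intro sym_lam_hull_segment) auto
  moreover have "v1 *\<^sub>R V1 + v2 *\<^sub>R V2 = r *\<^sub>R B"
    using r by (simp add: B_def scaleR_add_right)
  moreover have "v1 * det V1 + v2 * det V2 = r * det B"
    using r by (simp add: B_def det_convex_combination[OF one] d field_simps)
  ultimately show ?thesis by (rule that)
qed

text \<open>Averaging first within each pair leaves the sum of the determinants unchanged, so the hypothesis
  says that the two barycentres are compatible.\<close>

lemma two_rank_one_pairs: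
  assumes mem: "V1 \<in> sym_lam_hull \<U>" "V2 \<in> sym_lam_hull \<U>" "W1 \<in> sym_lam_hull \<U>" "W2 \<in> sym_lam_hull \<U>"
    and U: "\<U> \<subseteq> sym_matrices"
    and d: "det (V1 - V2) = 0" "det (W1 - W2) = 0"
    and w: "v1 \<ge> 0" "v2 \<ge> 0" "w1 \<ge> 0" "w2 \<ge> 0" "v1 + v2 + w1 + w2 = 1"
    and le: "v1 * det V1 + v2 * det V2 + w1 * det W1 + w2 * det W2
      \<le> det (v1 *\<^sub>R V1 + v2 *\<^sub>R V2 + w1 *\<^sub>R W1 + w2 *\<^sub>R W2)"
  shows "v1 *\<^sub>R V1 + v2 *\<^sub>R V2 + w1 *\<^sub>R W1 + w2 *\<^sub>R W2 \<in> sym_lam_hull \<U>"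
proof -
  obtain B where B: "B \<in> sym_lam_hull \<U>" "v1 *\<^sub>R V1 + v2 *\<^sub>R V2 = (v1 + v2) *\<^sub>R B"
      "v1 * det V1 + v2 * det V2 = (v1 + v2) * det B"
    by (rule rank_one_pair_barycentre[OF mem(1,2) U d(1) w(1,2) refl])
  obtain C where C: "C \<in> sym_lam_hull \<U>" "w1 *\<^sub>R W1 + w2 *\<^sub>R W2 = (w1 + w2) *\<^sub>R C"
      "w1 * det W1 + w2 * det W2 = (w1 + w2) * det C"
    by (rule rank_one_pair_barycentre[OF mem(3,4) U d(2) w(3,4) refl])
  have one: "(v1 + v2) + (w1 + w2) = 1" using w by simp
  have eq: "v1 *\<^sub>R V1 + v2 *\<^sub>R V2 + w1 *\<^sub>R W1 + w2 *\<^sub>R W2 = (v1 + v2) *\<^sub>R B + (w1 + w2) *\<^sub>R C"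
    using B(2) C(2) by (simp add: add.assoc)
  have le': "(v1 + v2) * (w1 + w2) * det (B - C) \<le> 0"
    using le B(3) C(3) unfolding eq det_convex_combination[OF one] by linarith
  show ?thesis
  proof (cases "v1 + v2 = 0 \<or> w1 + w2 = 0")
    case True
    then show ?thesis unfolding eq using B(1) C(1) one by auto
  next
    case False
    then have "(v1 + v2) * (w1 + w2) > 0" using w by (simp add: add_nonneg_nonneg less_le)
    then have "det (B - C) \<le> 0" using le' by (meson mult_pos_pos not_le)
    moreover have "B \<in> sym_matrices" "C \<in> sym_matrices" using B C sym_lam_hull_subset_sym[OF U] by auto
    ultimately have "compatible B C" by (simp add: compatible_iff_det)
    then show ?thesis unfolding eq using B(1) C(1) w one by (intro sym_lam_hull_segment) auto
  qed
qed

lemma mixtures_two_rank_one_pairs: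
  assumes U: "\<U> = {V1, V2, W1, W2}" "distinct [V1, V2, W1, W2]" "\<U> \<subseteq> sym_matrices"
    and d: "det (V1 - V2) = 0" "det (W1 - W2) = 0"
  shows "mixtures_in_lam_hull \<U>"
  unfolding mixtures_in_lam_hull_def
proof (intro allI impI)
  fix w assume w: "\<forall>M\<in>\<U>. w M \<ge> 0" "sum w \<U> = 1"
    "(\<Sum>M\<in>\<U>. w M * det M) \<le> det (\<Sum>M\<in>\<U>. w M *\<^sub>R M)"
  have sum4: "sum h \<U> = h V1 + h V2 + h W1 + h W2" for h :: "real^2^2 \<Rightarrow> 'b::comm_monoid_add"
    using U(2) by (simp add: U(1) add.assoc)
  show "(\<Sum>M\<in>\<U>. w M *\<^sub>R M) \<in> sym_lam_hull \<U>"
    using w(2,3) unfolding sum4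
    by (intro two_rank_one_pairs[OF _ _ _ _ U(3) d])
       (use w(1) U(1) subset_sym_lam_hull[of \<U>] in auto)
qed

text \<open>The weight of the middle well is split between the ends. This changes neither the
  barycentre nor, det being affine on the line, the determinant sum. The fourth well is paired with
  a copy of itself of weight zero.\<close>

lemma mixtures_three_collinear:
  assumes U: "\<U> = {V1, V2, V3, Z}" "distinct [V1, V2, V3, Z]" "\<U> \<subseteq> sym_matrices"
    and d: "det (V1 - V3) = 0" and r: "V2 = (1 - r) *\<^sub>R V1 + r *\<^sub>R V3" "0 \<le> r" "r \<le> 1"
  shows "mixtures_in_lam_hull \<U>"
  unfolding mixtures_in_lam_hull_def
proof (intro allI impI)
  fix w assume w: "\<forall>M\<in>\<U>. w M \<ge> 0" "sum w \<U> = 1"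
    "(\<Sum>M\<in>\<U>. w M * det M) \<le> det (\<Sum>M\<in>\<U>. w M *\<^sub>R M)"
  have sum4: "sum h \<U> = h V1 + h V2 + h V3 + h Z" for h :: "real^2^2 \<Rightarrow> 'b::comm_monoid_add"
    using U(2) by (simp add: U(1) add.assoc)
  have eq: "(\<Sum>M\<in>\<U>. w M *\<^sub>R M) =
      (w V1 + (1 - r) * w V2) *\<^sub>R V1 + (w V3 + r * w V2) *\<^sub>R V3 + w Z *\<^sub>R Z + 0 *\<^sub>R Z"
    unfolding sum4 by (subst (2) r(1)) (simp add: algebra_simps)
  have det2: "det V2 = (1 - r) * det V1 + r * det V3"
    unfolding r(1) using d by (subst det_convex_combination) auto
  have dsum: "(\<Sum>M\<in>\<U>. w M * det M) =
      (w V1 + (1 - r) * w V2) * det V1 + (w V3 + r * w V2) * det V3 + w Z * det Z + 0 * det Z"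
    unfolding sum4 det2 by (simp add: algebra_simps)
  show "(\<Sum>M\<in>\<U>. w M *\<^sub>R M) \<in> sym_lam_hull \<U>"
    unfolding eq
  proof (rule two_rank_one_pairs[OF _ _ _ _ U(3) d])
    show "V1 \<in> sym_lam_hull \<U>" "V3 \<in> sym_lam_hull \<U>" "Z \<in> sym_lam_hull \<U>" "Z \<in> sym_lam_hull \<U>"
      using U(1) subset_sym_lam_hull[of \<U>] by auto
    show "det (Z - Z) = 0" by (simp add: det_2)
    show "w V1 + (1 - r) * w V2 \<ge> 0" "w V3 + r * w V2 \<ge> 0" "w Z \<ge> 0"
      using w(1) U(1) r(2,3) by auto
    show "w V1 + (1 - r) * w V2 + (w V3 + r * w V2) + w Z + 0 = 1"
      using w(2) unfolding sum4 by (simp add: algebra_simps)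
  qed (use w(3) in \<open>simp_all only: dsum eq order_refl\<close>)
qed

section \<open>Plane sets closed under segments between comparable points\<close>

lemma triangle_below_diagonal:
  fixes S :: "real \<Rightarrow> real \<Rightarrow> bool"
  assumes seg: "\<And>x1 y1 x2 y2 u v. S x1 y1 \<Longrightarrow> S x2 y2 \<Longrightarrow> (x1 - x2) * (y1 - y2) \<ge> 0 \<Longrightarrow> u \<ge> 0 \<Longrightarrow> v \<ge> 0 \<Longrightarrow>
      u + v = 1 \<Longrightarrow> S (u * x1 + v * x2) (u * y1 + v * y2)"
    and S: "S 0 0" "S b 0" "S p q" and pos: "b > 0" "p > 0" "q > 0"
    and XY: "0 \<le> Y" "X \<le> p" "Y \<le> q" "Y * p \<le> X * q" "X * q - Y * p \<le> (q - Y) * b"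
  shows "S X Y"
proof (cases "Y = q")
  case True
  then have "X = p" using XY(2,4) pos by (simp add: mult.commute)
  with True S show ?thesis by simp
next
  case False
  define t where "t = Y / q"
  \<comment> \<open>The line from (p, q) through (X, Y) meets the horizontal axis at x. The last two
    hypotheses put x between 0 and b, and \<open>X \<le> p\<close> keeps it left of p, so (x, 0) is
    comparable with (p, q).\<close>
  define x where "x = (X * q - Y * p) / (q - Y)"
  have Yq: "q - Y > 0" using False XY by simp
  have x: "0 \<le> x" "x \<le> b" using Yq XY(4,5) by (simp_all add: x_def divide_le_eq mult.commute)
  have "X * q \<le> p * q" using XY(2) pos by (intro mult_right_mono) auto
  then have "x \<le> p" using Yq by (simp add: x_def divide_le_eq algebra_simps)
  have "S ((1 - x / b) * 0 + (x / b) * b) ((1 - x / b) * 0 + (x / b) * 0)"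
    by (rule seg[OF S(1,2)]) (use x pos in auto)
  then have "S x 0" using pos by simp
  have t: "0 \<le> t" "t \<le> 1" using XY pos by (simp_all add: t_def)
  have "S ((1 - t) * x + t * p) ((1 - t) * 0 + t * q)"
    by (rule seg[OF \<open>S x 0\<close> S(3)]) (use t pos \<open>x \<le> p\<close> in \<open>auto simp: mult_nonpos_nonneg\<close>)
  moreover have "(1 - t) * x + t * p = X"
  proof -
    have "(1 - t) * x = (q - Y) / q * x" using pos by (simp add: t_def diff_divide_distrib)
    also have "\<dots> = (X * q - Y * p) / q" using Yq by (simp add: x_def)
    finally show ?thesis using pos by (simp add: t_def field_simps)
  qed
  moreover have "t * q = Y" using pos by (simp add: t_def)
  ultimately show ?thesis by simp
qed

text \<open>Away from the axes, the weight inequality with \<open>X \<ge> wz * p\<close> and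
  \<open>Y \<ge> wz * q\<close> confines (X, Y) to the rectangle [0, p] x [0, q]. Below the diagonal
  to (p, q) the triangle with corner (b, 0) is used, above it the mirrored triangle with corner (0,
  d).\<close>

lemma first_quadrant_mixture:
  fixes S :: "real \<Rightarrow> real \<Rightarrow> bool"
  assumes seg: "\<And>x1 y1 x2 y2 u v. S x1 y1 \<Longrightarrow> S x2 y2 \<Longrightarrow> (x1 - x2) * (y1 - y2) \<ge> 0 \<Longrightarrow> u \<ge> 0 \<Longrightarrow> v \<ge> 0 \<Longrightarrow>
      u + v = 1 \<Longrightarrow> S (u * x1 + v * x2) (u * y1 + v * y2)"
    and S: "S 0 0" "S b 0" "S 0 d" "S p q" and pos: "b > 0" "d > 0" "p > 0" "q > 0"
    and w: "wb \<ge> 0" "wd \<ge> 0" "wz \<ge> 0" "wb + wd + wz \<le> 1"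
    and X: "X = wb * b + wz * p" and Y: "Y = wd * d + wz * q" and le: "X * Y \<le> wz * (p * q)"
  shows "S X Y"
proof -
  have nonneg: "X \<ge> 0" "Y \<ge> 0" "X \<ge> wz * p" "Y \<ge> wz * q" using w pos by (simp_all add: X Y)
  consider "X = 0" | "Y = 0" | "X > 0" "Y > 0" using nonneg by linarith
  then show ?thesis
  proof cases
    case 1
    then have "wb * b = 0" "wz * p = 0" using w pos by (auto simp: X add_nonneg_eq_0_iff)
    then have "wz = 0" using pos by simp
    have "S ((1 - wd) * 0 + wd * 0) ((1 - wd) * 0 + wd * d)"
      by (rule seg[OF S(1,3)]) (use w in auto)
    then show ?thesis using 1 \<open>wz = 0\<close> by (simp add: Y)
  next
    case 2
    then have "wd * d = 0" "wz * q = 0" using w pos by (auto simp: Y add_nonneg_eq_0_iff)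
    then have "wz = 0" using pos by simp
    have "S ((1 - wb) * 0 + wb * b) ((1 - wb) * 0 + wb * 0)"
      by (rule seg[OF S(1,2)]) (use w in auto)
    then show ?thesis using 2 \<open>wz = 0\<close> by (simp add: X)
  next
    case 3
    have "X * Y \<le> X * q"
    proof -
      have "wz * p * q \<le> X * q" using nonneg(3) pos by (intro mult_right_mono) auto
      then show ?thesis using le unfolding mult.assoc by linarith
    qed
    then have Yq: "Y \<le> q" using 3 by simp
    have "Y * X \<le> Y * p"
    proof -
      have "wz * q * p \<le> Y * p" using nonneg(4) pos by (intro mult_right_mono) auto
      moreover have "wz * q * p = wz * (p * q)" "Y * X = X * Y" by (simp_all add: ac_simps)
      ultimately show ?thesis using le by linarith
    qed
    then have Xp: "X \<le> p" using 3 by simp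
    show ?thesis
    proof (cases "Y * p \<le> X * q")
      case True
      \<comment> \<open>(X, Y) lies on the inner side of the line through (b, 0) and (p, q): if
        \<open>b \<le> p\<close>, all four generating points do and hence every mixture; otherwise
        \<open>X \<le> p\<close> already ensures it.\<close>
      have key: "X * q - Y * p \<le> (q - Y) * b"
      proof (cases "b \<le> p")
        case True
        have "wb * (b * q) \<le> (1 - wd - wz) * (b * q)" using w pos by (intro mult_right_mono) auto
        moreover have "(wd * d) * b \<le> (wd * d) * p" using True w pos by (intro mult_left_mono) auto
        moreover have "0 \<le> wd * (b * q)" using w pos by simp
        ultimately show ?thesis by (simp add: X Y algebra_simps)
      next
        case False
        have "X * q \<le> p * q" using Xp pos by (intro mult_right_mono) auto
        moreover have "(q - Y) * p \<le> (q - Y) * b" using False Yq by (intro mult_left_mono) auto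
        ultimately show ?thesis by (simp add: algebra_simps)
      qed
      show ?thesis
        by (rule triangle_below_diagonal[where S = S and b = b and p = p and q = q])
           (fact seg S pos nonneg Xp Yq True key)+
    next
      case False
      have key: "Y * p - X * q \<le> (p - X) * d"
      proof (cases "d \<le> q")
        case True
        have "wd * (d * p) \<le> (1 - wb - wz) * (d * p)" using w pos by (intro mult_right_mono) auto
        moreover have "(wb * b) * d \<le> (wb * b) * q" using True w pos by (intro mult_left_mono) auto
        moreover have "0 \<le> wb * (d * p)" using w pos by simp
        ultimately show ?thesis by (simp add: X Y algebra_simps)
      next
        case False
        have "Y * p \<le> q * p" using Yq pos by (intro mult_right_mono) auto
        moreover have "(p - X) * q \<le> (p - X) * d" using False Xp by (intro mult_left_mono) auto
        ultimately show ?thesis by (simp add: algebra_simps)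
      qed
      \<comment> \<open>Comparability is symmetric in the coordinates, so the triangle argument
        applies with them exchanged.\<close>
      have seg': "S (u * y1 + v * y2) (u * x1 + v * x2)"
        if "S y1 x1" "S y2 x2" "(x1 - x2) * (y1 - y2) \<ge> 0" "u \<ge> 0" "v \<ge> 0" "u + v = 1" for x1 y1 x2 y2 u v
        by (rule seg) (use that in \<open>simp_all add: mult.commute\<close>)
      have "X * q \<le> Y * p" using False by simp
      show ?thesis
        by (rule triangle_below_diagonal[where S = "\<lambda>y x. S x y" and b = d and p = q and q = p])
           (fact seg' S pos nonneg Xp Yq \<open>X * q \<le> Y * p\<close> key)+
    qed
  qed
qed

text \<open>Here (p, q) is comparable with (0, s) exactly when s \<ge> q. For wz > 0 the weight
  inequality forces X < 0 and Y \<ge> q, so the mixture is (p, q) itself or on a segment from (p, q)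
  to such a point of the vertical leg.\<close>

lemma second_quadrant_mixture:
  fixes S :: "real \<Rightarrow> real \<Rightarrow> bool"
  assumes seg: "\<And>x1 y1 x2 y2 u v. S x1 y1 \<Longrightarrow> S x2 y2 \<Longrightarrow> (x1 - x2) * (y1 - y2) \<ge> 0 \<Longrightarrow> u \<ge> 0 \<Longrightarrow> v \<ge> 0 \<Longrightarrow>
      u + v = 1 \<Longrightarrow> S (u * x1 + v * x2) (u * y1 + v * y2)"
    and S: "S 0 0" "S b 0" "S 0 d" "S p q" and pos: "b > 0" "d > 0" "p < 0" "q > 0" "q \<le> d"
    and w: "wb \<ge> 0" "wd \<ge> 0" "wz \<ge> 0" "wb + wd + wz \<le> 1"
    and X: "X = wb * b + wz * p" and Y: "Y = wd * d + wz * q" and le: "X * Y \<le> wz * (p * q)"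
  shows "S X Y"
proof (cases "wz = 0")
  \<comment> \<open>Without the fourth point both coordinates are non-negative with product at most
    zero, so the mixture lies on a leg.\<close>
  case True
  then have "(wb * b) * (wd * d) \<le> 0" using le by (simp add: X Y)
  moreover have "wb * b \<ge> 0" "wd * d \<ge> 0" using w pos by auto
  ultimately have "wb * b = 0 \<or> wd * d = 0" by (meson mult_pos_pos not_le order_le_less)
  then consider "wb = 0" | "wd = 0" using pos by auto
  then show ?thesis
  proof cases
    case 1
    have "S ((1 - wd) * 0 + wd * 0) ((1 - wd) * 0 + wd * d)"
      by (rule seg[OF S(1,3)]) (use w in auto)
    then show ?thesis using 1 True by (simp add: X Y)
  next
    case 2
    have "S ((1 - wb) * 0 + wb * b) ((1 - wb) * 0 + wb * 0)"
      by (rule seg[OF S(1,2)]) (use w in auto)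
    then show ?thesis using 2 True by (simp add: X Y)
  qed
next
  case False
  then have wz: "wz > 0" using w by simp
  have "wz * (p * q) < 0" using wz pos by (simp add: mult_pos_neg mult_neg_pos)
  with le have "X * Y < 0" by simp
  moreover have "Y \<ge> 0" using w pos by (simp add: Y)
  ultimately have X0: "X < 0" by (simp add: mult_less_0_iff)
  \<comment> \<open>Subtracting \<open>X * q\<close> from the weight inequality cancels the share of
    (p, q) and leaves the non-positive contribution of (b, 0).\<close>
  have "X * (Y - q) \<le> - (wb * b * q)" using le by (simp add: X algebra_simps)
  also have "\<dots> \<le> 0" using w pos by simp
  finally have Yq: "Y \<ge> q" using X0 by (simp add: mult_le_0_iff)
  \<comment> \<open>The weight of (p, q) on that segment, fixed by the abscissa; it is at most
    \<open>wz\<close> because (b, 0) pulls the other way.\<close>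
  define t where "t = X / p"
  have t: "0 \<le> t" using X0 pos by (simp add: t_def zero_le_divide_iff)
  have "X \<ge> wz * p" using w pos by (simp add: X)
  then have twz: "t \<le> wz" using pos by (simp add: t_def divide_le_eq)
  have tp: "t * p = X" using pos by (simp add: t_def)
  show ?thesis
  proof (cases "t = 1")
    case True
    then have "wz = 1" "wb = 0" "wd = 0" using twz w by auto
    then show ?thesis using S by (simp add: X Y)
  next
    case False
    then have t1: "1 - t > 0" using twz w by linarith
    \<comment> \<open>The height of the other end point on the vertical axis. It stays below d since
      \<open>q \<le> d\<close>: the excess weight \<open>wz - t\<close> at height q costs no more
      than at height d.\<close>
    define s where "s = (Y - t * q) / (1 - t)"
    have "q \<le> s" using Yq t1 by (simp add: s_def le_divide_eq algebra_simps)
    have "(wz - t) * q \<le> (wz - t) * d" using twz pos by (intro mult_left_mono) auto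
    also have "\<dots> \<le> (1 - t - wd) * d" using w pos by (intro mult_right_mono) auto
    finally have "s \<le> d" using t1 by (simp add: s_def divide_le_eq Y algebra_simps)
    have s0: "s > 0" using \<open>q \<le> s\<close> pos by simp
    have "S ((1 - s / d) * 0 + (s / d) * 0) ((1 - s / d) * 0 + (s / d) * d)"
      by (rule seg[OF S(1,3)]) (use s0 \<open>s \<le> d\<close> pos in auto)
    then have "S 0 s" using pos by simp
    have "S ((1 - t) * 0 + t * p) ((1 - t) * s + t * q)"
      by (rule seg[OF \<open>S 0 s\<close> S(4)]) (use t t1 pos \<open>q \<le> s\<close> in \<open>auto simp: mult_nonpos_nonneg\<close>)
    moreover have "(1 - t) * s + t * q = Y" using t1 by (simp add: s_def)
    ultimately show ?thesis using tp by simp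
  qed
qed

section \<open>Coordinates along the two rank-one directions\<close>

lemma cone_frame_cross_nonzero:
  assumes "cone_frame Q a n"
  shows "a $ 1 * n $ 2 - a $ 2 * n $ 1 \<noteq> 0"
proof
  assume cross: "a $ 1 * n $ 2 - a $ 2 * n $ 1 = 0"
  have frame: "norm a = 1" "a \<noteq> n" "independent {a, n}" using assms by (auto simp: cone_frame_def)
  have a1: "a $ 1 * a $ 1 + a $ 2 * a $ 2 = 1"
    using frame(1) by (simp add: norm_eq_1 inner_vec_def sum_2)
  have "n = (a \<bullet> n) *\<^sub>R a"
  proof -
    have "n $ 1 = (a $ 1 * n $ 1 + a $ 2 * n $ 2) * a $ 1" using a1 cross by algebra
    moreover have "n $ 2 = (a $ 1 * n $ 1 + a $ 2 * n $ 2) * a $ 2" using a1 cross by algebra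
    ultimately show ?thesis by (simp add: vec_eq_iff forall_2 inner_vec_def sum_2)
  qed
  then have "n \<in> span {a}" by (metis span_base span_scale singletonI)
  moreover have "{a, n} - {n} = {a}" using frame(2) by auto
  ultimately have "dependent {a, n}" unfolding dependent_def by (intro bexI[of _ n]) simp_all
  with frame(3) show False by simp
qed

lemma cone_frame_coordinates:
  assumes Q: "Q \<in> sym_matrices" "det Q < 0" and frame: "cone_frame Q a n"
    and M: "M \<in> sym_matrices" "Q \<bullet> M = 0"
  obtains x y where "M = x *\<^sub>R tensor (perp a) (perp a) + y *\<^sub>R tensor (perp n) (perp n)"
proof -
  define \<alpha>1 \<alpha>2 \<beta>1 \<beta>2 where ab: "\<alpha>1 = - (a $ 2)" "\<alpha>2 = a $ 1" "\<beta>1 = - (n $ 2)" "\<beta>2 = n $ 1"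
  define q11 q12 q22 where q: "q11 = Q $ 1 $ 1" "q12 = Q $ 1 $ 2" "q22 = Q $ 2 $ 2"
  define m11 m12 m22 where m: "m11 = M $ 1 $ 1" "m12 = M $ 1 $ 2" "m22 = M $ 2 $ 2"
  define d where "d = \<alpha>1 * \<beta>2 - \<alpha>2 * \<beta>1"
  have d0: "d \<noteq> 0" using cone_frame_cross_nonzero[OF frame] by (simp add: d_def ab algebra_simps)
  have sym: "Q $ 2 $ 1 = q12" "M $ 2 $ 1 = m12" using Q(1) M(1) by (auto simp: sym_matrices_iff q m)
  have qa: "q11 * \<alpha>1 * \<alpha>1 + 2 * q12 * \<alpha>1 * \<alpha>2 + q22 * \<alpha>2 * \<alpha>2 = 0"
    and qn: "q11 * \<beta>1 * \<beta>1 + 2 * q12 * \<beta>1 * \<beta>2 + q22 * \<beta>2 * \<beta>2 = 0"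
    using frame unfolding cone_frame_def
    by (simp_all add: inner_vec_def sum_2 tensor_def perp_simps ab q[symmetric] sym algebra_simps)
  have qm: "q11 * m11 + 2 * q12 * m12 + q22 * m22 = 0"
    using M(2) by (simp add: inner_vec_def sum_2 q[symmetric] m[symmetric] sym algebra_simps)
  have qdet: "q11 * q22 - q12 * q12 < 0" using Q(2) by (simp add: det_2 q[symmetric] sym)
  \<comment> \<open>The off-diagonal entry of the form Q in the basis of the two rotated vectors,
    where its diagonal entries vanish. Its square is \<open>- (d * d)\<close> times det Q, hence
    positive.\<close>
  define g where "g = q11 * \<alpha>1 * \<beta>1 + q12 * (\<alpha>1 * \<beta>2 + \<alpha>2 * \<beta>1) + q22 * \<alpha>2 * \<beta>2"
  have "g * g = - (d * d) * (q11 * q22 - q12 * q12)"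
    using qa qn unfolding g_def d_def by algebra
  moreover have "d * d > 0" using d0 by (auto simp: zero_less_mult_iff)
  ultimately have "g * g > 0" using qdet by (simp add: mult_pos_neg)
  then have g0: "g \<noteq> 0" by auto
  \<comment> \<open>Up to the factor \<open>d * d\<close>, these are the coefficients of M with
    respect to the two tensor squares and the symmetrised mixed product. Q vanishes on the squares,
    so orthogonality to Q leaves \<open>g * \<zeta> = 0\<close>.\<close>
  define \<xi> \<eta> \<zeta> where c: "\<xi> = m11 * \<beta>2 * \<beta>2 - 2 * m12 * \<beta>1 * \<beta>2 + m22 * \<beta>1 * \<beta>1"
    "\<eta> = m11 * \<alpha>2 * \<alpha>2 - 2 * m12 * \<alpha>1 * \<alpha>2 + m22 * \<alpha>1 * \<alpha>1"
    "\<zeta> = - (m11 * \<alpha>2 * \<beta>2) + m12 * (\<alpha>1 * \<beta>2 + \<alpha>2 * \<beta>1) - m22 * \<alpha>1 * \<beta>1"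
  have "2 * (g * \<zeta>) = d * d * (q11 * m11 + 2 * q12 * m12 + q22 * m22)
      - \<xi> * (q11 * \<alpha>1 * \<alpha>1 + 2 * q12 * \<alpha>1 * \<alpha>2 + q22 * \<alpha>2 * \<alpha>2)
      - \<eta> * (q11 * \<beta>1 * \<beta>1 + 2 * q12 * \<beta>1 * \<beta>2 + q22 * \<beta>2 * \<beta>2)"
    unfolding g_def d_def c by algebra
  then have "\<zeta> = 0" using g0 by (simp add: qm qa qn)
  have e: "d * d * m11 = \<xi> * (\<alpha>1 * \<alpha>1) + \<eta> * (\<beta>1 * \<beta>1) + 2 * \<zeta> * (\<alpha>1 * \<beta>1)"
    "d * d * m12 = \<xi> * (\<alpha>1 * \<alpha>2) + \<eta> * (\<beta>1 * \<beta>2) + \<zeta> * (\<alpha>1 * \<beta>2 + \<alpha>2 * \<beta>1)"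
    "d * d * m22 = \<xi> * (\<alpha>2 * \<alpha>2) + \<eta> * (\<beta>2 * \<beta>2) + 2 * \<zeta> * (\<alpha>2 * \<beta>2)"
    unfolding d_def c by algebra+
  have dd: "d * d \<noteq> 0" using d0 by simp
  have "m11 = \<xi> / (d * d) * (\<alpha>1 * \<alpha>1) + \<eta> / (d * d) * (\<beta>1 * \<beta>1)"
    "m12 = \<xi> / (d * d) * (\<alpha>1 * \<alpha>2) + \<eta> / (d * d) * (\<beta>1 * \<beta>2)"
    "m22 = \<xi> / (d * d) * (\<alpha>2 * \<alpha>2) + \<eta> / (d * d) * (\<beta>2 * \<beta>2)"
    using e \<open>\<zeta> = 0\<close> dd by (simp_all add: add_divide_distrib[symmetric] eq_divide_eq mult.commute)
  then have "M = (\<xi> / (d * d)) *\<^sub>R tensor (perp a) (perp a) + (\<eta> / (d * d)) *\<^sub>R tensor (perp n) (perp n)"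
    by (simp add: vec_eq_iff forall_2 tensor_def perp_simps ab[symmetric] m[symmetric] sym mult.commute)
  then show ?thesis by (rule that)
qed

text \<open>The second coordinate is \<open>- \<eta>\<close>, so that compatible points are those comparable in the product order.\<close>

definition frame_point :: "real^2 \<Rightarrow> real^2 \<Rightarrow> real^2^2 \<Rightarrow> real \<Rightarrow> real \<Rightarrow> real^2^2" where
  "frame_point a n V x y = V + x *\<^sub>R tensor (perp a) (perp a) - y *\<^sub>R tensor (perp n) (perp n)"

lemma frame_point_sym: "V \<in> sym_matrices \<Longrightarrow> frame_point a n V x y \<in> sym_matrices"
  by (simp add: frame_point_def sym_matrices_iff tensor_def)

lemma frame_point_origin [simp]: "frame_point a n V 0 0 = V"
  by (simp add: frame_point_def)

text \<open>Both directions have rank one, so only the mixed term survives; its coefficient is the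
  squared cross product of a and n.\<close>

lemma det_frame_point_diff:
  "det (frame_point a n V x1 y1 - frame_point a n V x2 y2)
    = - (a $ 1 * n $ 2 - a $ 2 * n $ 1)\<^sup>2 * ((x1 - x2) * (y1 - y2))"
  by (simp add: frame_point_def det_2 tensor_def perp_simps power2_eq_square algebra_simps)

text \<open>Only the coefficient of x * y is made explicit: the affine part averages out in every
  mixture.\<close>

lemma det_frame_point:
  obtains l1 l2 where "\<And>x y. det (frame_point a n V x y)
    = det V + x * l1 + y * l2 - (a $ 1 * n $ 2 - a $ 2 * n $ 1)\<^sup>2 * (x * y)"
proof (rule that)
  fix x y
  show "det (frame_point a n V x y) = det V
    + x * (det (V + tensor (perp a) (perp a)) - det V)
    + y * (det (V - tensor (perp n) (perp n)) - det V)
    - (a $ 1 * n $ 2 - a $ 2 * n $ 1)\<^sup>2 * (x * y)"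
    by (simp add: frame_point_def det_2 tensor_def perp_simps power2_eq_square algebra_simps)
qed

lemma compatible_frame_point:
  assumes "cone_frame Q a n" "V \<in> sym_matrices"
  shows "compatible (frame_point a n V x1 y1) (frame_point a n V x2 y2) \<longleftrightarrow> (x1 - x2) * (y1 - y2) \<ge> 0"
proof -
  have "(a $ 1 * n $ 2 - a $ 2 * n $ 1)\<^sup>2 > 0"
    using cone_frame_cross_nonzero[OF assms(1)] by simp
  then show ?thesis
    unfolding compatible_iff_det[OF frame_point_sym[OF assms(2)] frame_point_sym[OF assms(2)]] det_frame_point_diff
    by (simp add: mult_le_0_iff zero_le_mult_iff)
qed

text \<open>The ends of the two legs are not comparable, while a point with both coordinates
  negative lies below both of them and puts \<open>V\<close> strictly inside the triangle.\<close>

lemma wedge_configurationI: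
  assumes frame: "cone_frame Q a n" and V: "V \<in> sym_matrices"
    and pos: "b > 0" "d > 0" "p < 0" "q < 0"
    and \<U>: "\<U> = {V, frame_point a n V b 0, frame_point a n V 0 d, frame_point a n V p q}"
      "distinct [V, frame_point a n V b 0, frame_point a n V 0 d, frame_point a n V p q]"
  shows "wedge_configuration \<U>"
proof -
  define U1 U2 U3 where U: "U1 = frame_point a n V b 0" "U2 = frame_point a n V 0 d" "U3 = frame_point a n V p q"
  have comp: "compatible U1 U3" "compatible U3 U1" "compatible U2 U3" "compatible U3 U2" "\<not> compatible U1 U2"
    unfolding U compatible_frame_point[OF frame V]
    using pos by (auto simp: zero_le_mult_iff mult_le_0_iff)
  have dist: "V \<noteq> U1" "V \<noteq> U2" "V \<noteq> U3" "U1 \<noteq> U2" "U1 \<noteq> U3" "U2 \<noteq> U3" using \<U>(2) by (auto simp: U)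
  have P: "{P. P \<subseteq> {U1, U2, U3} \<and> card P = 2 \<and> (\<exists>A\<in>P. \<exists>B\<in>P. \<not> compatible A B)} = {{U1, U2}}"
  proof (intro set_eqI iffI)
    fix P assume "P \<in> {P. P \<subseteq> {U1, U2, U3} \<and> card P = 2 \<and> (\<exists>A\<in>P. \<exists>B\<in>P. \<not> compatible A B)}"
    then obtain A B where P: "P \<subseteq> {U1, U2, U3}" "card P = 2" "A \<in> P" "B \<in> P" "\<not> compatible A B" by auto
    then have "A \<in> {U1, U2, U3}" "B \<in> {U1, U2, U3}" by blast+
    with P(5) comp have "(A = U1 \<and> B = U2) \<or> (A = U2 \<and> B = U1)" by auto
    with P(3,4) have "{U1, U2} \<subseteq> P" by auto
    moreover have "finite P" using P(1) finite_subset by blast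
    ultimately show "P \<in> {{U1, U2}}"
      using P(2) card_subset_eq[of P "{U1, U2}"] dist by auto
  qed (use comp dist in auto)
  \<comment> \<open>Normalises the barycentric weights: relative to the third vertex, the leg ends
    need \<open>- p / b\<close> and \<open>- q / d\<close> to cancel its coordinates.\<close>
  define s where "s = 1 / (1 - p / b - q / d)"
  have den: "1 - p / b - q / d > 1" using divide_neg_pos[OF pos(3,1)] divide_neg_pos[OF pos(4,2)] by linarith
  then have s: "s > 0" by (simp add: s_def)
  define u where "u M = (if M = U1 then - s * p / b else if M = U2 then - s * q / d else s)" for M
  have "V \<in> rel_interior (convex hull {U1, U2, U3})"
  proof (rule subsetD[OF explicit_subset_rel_interior_convex_hull_minimal])
    have "(\<forall>M\<in>{U1, U2, U3}. 0 < u M)"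
      using s pos by (auto simp: u_def divide_pos_pos mult_pos_neg divide_neg_pos mult_neg_pos)
    moreover have "sum u {U1, U2, U3} = 1"
    proof -
      have "sum u {U1, U2, U3} = s * (1 - p / b - q / d)"
        using dist by (simp add: u_def algebra_simps)
      then show ?thesis using den by (simp add: s_def)
    qed
    moreover have "(\<Sum>M\<in>{U1, U2, U3}. u M *\<^sub>R M) = V"
    proof -
      have "(\<Sum>M\<in>{U1, U2, U3}. u M *\<^sub>R M) = u U1 *\<^sub>R U1 + u U2 *\<^sub>R U2 + u U3 *\<^sub>R U3"
        using dist by simp
      also have "\<dots> = (u U1 + u U2 + u U3) *\<^sub>R V + (u U1 * b + u U3 * p) *\<^sub>R tensor (perp a) (perp a)
          - (u U2 * d + u U3 * q) *\<^sub>R tensor (perp n) (perp n)"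
        by (simp add: U frame_point_def algebra_simps)
      also have "u U1 + u U2 + u U3 = 1"
        using calculation(1) \<open>sum u {U1, U2, U3} = 1\<close> dist by (simp add: add.assoc)
      also have "u U1 * b + u U3 * p = 0" using dist pos by (simp add: u_def)
      also have "u U2 * d + u U3 * q = 0" using dist pos by (simp add: u_def)
      finally show ?thesis by simp
    qed
    ultimately show "V \<in> {y. \<exists>u. (\<forall>x\<in>{U1, U2, U3}. 0 < u x) \<and> sum u {U1, U2, U3} = 1 \<and>
        (\<Sum>x\<in>{U1, U2, U3}. u x *\<^sub>R x) = y}" by blast
  qed simp
  moreover have "\<forall>M\<in>{U1, U2}. rank_one_compatible V M"
    using det_frame_point_diff[of a n V 0 0 b 0] det_frame_point_diff[of a n V 0 0 0 d]
    unfolding rank_one_compatible_def rank_le_1_iff_det U by simp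
  moreover have "distinct [V, U1, U2, U3]" "\<U> = {V, U1, U2, U3}"
    using \<U> unfolding U by blast+
  ultimately show ?thesis
    unfolding wedge_configuration_def using P by blast
qed

text \<open>If (p, q) is on one of the axes through \<open>V\<close>, the fourth well and a leg end
  form a second rank-one pair; if both coordinates are negative, the wells form a wedge; the other
  quadrants are the planar estimates.\<close>

lemma mixtures_L_shape:
  assumes frame: "cone_frame Q a n" and V: "V \<in> sym_matrices" and pos: "b > 0" "d > 0"
    and \<U>: "\<U> = {V, frame_point a n V b 0, frame_point a n V 0 d, frame_point a n V p q}"
      "distinct [V, frame_point a n V b 0, frame_point a n V 0 d, frame_point a n V p q]"
    and comp: "\<exists>M\<in>\<U>. M \<noteq> frame_point a n V p q \<and> compatible (frame_point a n V p q) M"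
    and nw: "\<not> wedge_configuration \<U>"
  shows "mixtures_in_lam_hull \<U>"
proof -
  let ?P = "frame_point a n V"
  note compat = compatible_frame_point[OF frame V]
  have sym: "\<U> \<subseteq> sym_matrices" using V by (auto simp: \<U>(1) frame_point_sym)
  have comp': "p * q \<ge> 0 \<or> (p - b) * q \<ge> 0 \<or> p * (q - d) \<ge> 0"
    using comp compat[of p q 0 0] compat[of p q b 0] compat[of p q 0 d] by (auto simp: \<U>(1))
  define S where "S x y \<longleftrightarrow> ?P x y \<in> sym_lam_hull \<U>" for x y
  have S: "S 0 0" "S b 0" "S 0 d" "S p q"
    using subset_sym_lam_hull[of \<U>] by (auto simp: S_def \<U>(1))
  have seg: "S (u * x1 + v * x2) (u * y1 + v * y2)"
    if "S x1 y1" "S x2 y2" "(x1 - x2) * (y1 - y2) \<ge> 0" "u \<ge> 0" "v \<ge> 0" "u + v = 1" for x1 y1 x2 y2 u v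
  proof -
    have "u *\<^sub>R ?P x1 y1 + v *\<^sub>R ?P x2 y2 \<in> sym_lam_hull \<U>"
      using that by (intro sym_lam_hull_segment) (simp_all add: S_def compat)
    also have "u *\<^sub>R ?P x1 y1 + v *\<^sub>R ?P x2 y2 = (u + v) *\<^sub>R V
        + (u * x1 + v * x2) *\<^sub>R tensor (perp a) (perp a) - (u * y1 + v * y2) *\<^sub>R tensor (perp n) (perp n)"
      by (simp add: frame_point_def algebra_simps)
    finally show ?thesis using that(6) by (simp add: S_def frame_point_def)
  qed
  \<comment> \<open>The affine parts of det cancel, and the corner and both leg ends have coordinate
    product zero, so only the fourth well contributes to the averaged product.\<close>
  have reduce: ?thesis
    if claim: "\<And>wb wd wz. wb \<ge> 0 \<Longrightarrow> wd \<ge> 0 \<Longrightarrow> wz \<ge> 0 \<Longrightarrow> wb + wd + wz \<le> 1 \<Longrightarrow>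
      (wb * b + wz * p) * (wd * d + wz * q) \<le> wz * (p * q) \<Longrightarrow> S (wb * b + wz * p) (wd * d + wz * q)"
    unfolding mixtures_in_lam_hull_def
  proof (intro allI impI)
    fix w assume w: "\<forall>M\<in>\<U>. w M \<ge> 0" "sum w \<U> = 1"
      "(\<Sum>M\<in>\<U>. w M * det M) \<le> det (\<Sum>M\<in>\<U>. w M *\<^sub>R M)"
    have sum4: "sum h \<U> = h V + h (?P b 0) + h (?P 0 d) + h (?P p q)" for h :: "real^2^2 \<Rightarrow> 'b::comm_monoid_add"
      using \<U>(2) by (simp add: \<U>(1) add.assoc)
    define w0 wb wd wz where ws: "w0 = w V" "wb = w (?P b 0)" "wd = w (?P 0 d)" "wz = w (?P p q)"
    have nonneg: "w0 \<ge> 0" "wb \<ge> 0" "wd \<ge> 0" "wz \<ge> 0" using w(1) by (auto simp: ws \<U>(1))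
    have one: "w0 + wb + wd + wz = 1" using w(2) unfolding sum4 ws .
    let ?X = "wb * b + wz * p" and ?Y = "wd * d + wz * q"
    have "(\<Sum>M\<in>\<U>. w M *\<^sub>R M) = (w0 + wb + wd + wz) *\<^sub>R V + ?X *\<^sub>R tensor (perp a) (perp a) - ?Y *\<^sub>R tensor (perp n) (perp n)"
      unfolding sum4 ws[symmetric] by (simp add: frame_point_def algebra_simps)
    then have bary: "(\<Sum>M\<in>\<U>. w M *\<^sub>R M) = ?P ?X ?Y"
      by (simp add: one frame_point_def)
    define k where "k = (a $ 1 * n $ 2 - a $ 2 * n $ 1)\<^sup>2"
    have k: "k > 0" using cone_frame_cross_nonzero[OF frame] by (simp add: k_def)
    obtain l1 l2 where dt: "\<And>x y. det (?P x y) = det V + x * l1 + y * l2 - k * (x * y)"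
      unfolding k_def using det_frame_point by metis
    have "(\<Sum>M\<in>\<U>. w M * det M) = (w0 + wb + wd + wz) * det V + ?X * l1 + ?Y * l2 - k * (wz * (p * q))"
      unfolding sum4 ws[symmetric] dt by (simp add: algebra_simps)
    then have "k * (?X * ?Y) \<le> k * (wz * (p * q))"
      using w(3) unfolding bary dt one by linarith
    then have "?X * ?Y \<le> wz * (p * q)" using k by (simp only: mult_le_cancel_left_pos)
    then have "S ?X ?Y" using nonneg one by (intro claim) auto
    then show "(\<Sum>M\<in>\<U>. w M *\<^sub>R M) \<in> sym_lam_hull \<U>" by (simp only: bary S_def)
  qed
  consider "p = 0" | "q = 0" | "p < 0" "q < 0" | "p > 0" "q > 0" | "p < 0" "q > 0" "q \<le> d" | "p > 0" "q < 0" "p \<le> b"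
  proof -
    \<comment> \<open>In a mixed quadrant only the end of the adjacent leg can be compatible with
      the fourth well, and only within the length of that leg.\<close>
    have "q \<le> d" if "p < 0" "q > 0" using comp' that pos by (auto simp: zero_le_mult_iff)
    moreover have "p \<le> b" if "p > 0" "q < 0" using comp' that pos by (auto simp: zero_le_mult_iff)
    ultimately show thesis
      using that linorder_less_linear[of p 0] linorder_less_linear[of q 0] by blast
  qed
  then show ?thesis
  proof cases
    case 1
    then show ?thesis
      using \<U> sym det_frame_point_diff[of a n V 0 d p q] det_frame_point_diff[of a n V 0 0 b 0]
      by (intro mixtures_two_rank_one_pairs[of \<U> V "?P b 0" "?P 0 d" "?P p q"]) auto
  next
    case 2
    then show ?thesis
      using \<U> sym det_frame_point_diff[of a n V b 0 p q] det_frame_point_diff[of a n V 0 0 0 d]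
      by (intro mixtures_two_rank_one_pairs[of \<U> V "?P 0 d" "?P b 0" "?P p q"]) auto
  next
    case 3
    then show ?thesis using wedge_configurationI[OF frame V pos _ _ \<U>] nw by blast
  next
    case quad: 4
    show ?thesis
    proof (rule reduce)
      fix wb wd wz :: real
      assume w: "wb \<ge> 0" "wd \<ge> 0" "wz \<ge> 0" "wb + wd + wz \<le> 1"
        and le: "(wb * b + wz * p) * (wd * d + wz * q) \<le> wz * (p * q)"
      show "S (wb * b + wz * p) (wd * d + wz * q)"
        by (rule first_quadrant_mixture[where S = S and b = b and d = d and p = p and q = q
              and wb = wb and wd = wd and wz = wz])
           (fact seg S pos quad refl w le)+
    qed
  next
    case quad: 5
    show ?thesis
    proof (rule reduce)
      fix wb wd wz :: real
      assume w: "wb \<ge> 0" "wd \<ge> 0" "wz \<ge> 0" "wb + wd + wz \<le> 1"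
        and le: "(wb * b + wz * p) * (wd * d + wz * q) \<le> wz * (p * q)"
      show "S (wb * b + wz * p) (wd * d + wz * q)"
        by (rule second_quadrant_mixture[where S = S and b = b and d = d and p = p and q = q
              and wb = wb and wd = wd and wz = wz])
           (fact seg S pos quad refl w le)+
    qed
  next
    case quad: 6
    \<comment> \<open>Mirror image of the previous quadrant, with the legs exchanged.\<close>
    have seg': "S (u * y1 + v * y2) (u * x1 + v * x2)"
      if "S y1 x1" "S y2 x2" "(x1 - x2) * (y1 - y2) \<ge> 0" "u \<ge> 0" "v \<ge> 0" "u + v = 1" for x1 y1 x2 y2 u v
      by (rule seg) (use that in \<open>simp_all add: mult.commute\<close>)
    show ?thesis
    proof (rule reduce)
      fix wb wd wz :: real
      assume w: "wb \<ge> 0" "wd \<ge> 0" "wz \<ge> 0" "wb + wd + wz \<le> 1"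
        and le: "(wb * b + wz * p) * (wd * d + wz * q) \<le> wz * (p * q)"
      have w': "wd + wb + wz \<le> 1" and le': "(wd * d + wz * q) * (wb * b + wz * p) \<le> wz * (q * p)"
        using w(4) le by (simp_all add: ac_simps)
      show "S (wb * b + wz * p) (wd * d + wz * q)"
        by (rule second_quadrant_mixture[where S = "\<lambda>y x. S x y" and b = d and d = b and p = q and q = p
              and wb = wd and wd = wb and wz = wz])
           (fact seg' S pos quad refl w w' le')+
    qed
  qed
qed

section \<open>Wells on the legs of a half cone\<close>

lemma mixtures_same_ray:
  assumes V: "V \<in> sym_matrices" and \<U>: "\<U> = {V, V', W', Z}" "distinct [V, V', W', Z]" "\<U> \<subseteq> sym_matrices"
    and T: "V' = V + b *\<^sub>R T" "W' = V + c *\<^sub>R T" "det T = 0" "b > 0" "c > 0"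
  shows "mixtures_in_lam_hull \<U>"
proof -
  \<comment> \<open>\<open>V\<close> is the end of the ray, so the nearer of the other two wells
    lies between; stating this for an ordered pair covers both orders.\<close>
  have main: "mixtures_in_lam_hull \<U>"
    if "\<U> = {V, X, Y, Z}" "distinct [V, X, Y, Z]" "X = V + x *\<^sub>R T" "Y = V + y *\<^sub>R T" "0 < x" "x \<le> y" for X Y x y
  proof (rule mixtures_three_collinear[OF that(1,2) \<U>(3)])
    have "V - Y = (- y) *\<^sub>R T" by (simp add: that)
    then show "det (V - Y) = 0" by (simp only: det_scaleR_2 T(3))
    show "X = (1 - x / y) *\<^sub>R V + (x / y) *\<^sub>R Y"
      using that(5,6) by (simp add: that(3,4) algebra_simps)
    show "0 \<le> x / y" "x / y \<le> 1" using that(5,6) by auto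
  qed
  show ?thesis
  proof (cases "b \<le> c")
    case True
    show ?thesis by (rule main[OF \<U>(1,2) T(1,2,4) True])
  next
    case False
    show ?thesis
      by (rule main[OF _ _ T(2,1,5)]) (use \<U>(1,2) False in auto)
  qed
qed

text \<open>Rank-one compatibility with the corner makes the product of the coordinates vanish, and
  the upper part fixes their signs.\<close>

lemma upper_cone_rank_one:
  assumes frame: "cone_frame Q a n" and M: "M \<in> upper_cone a n V" "det (M - V) = 0" "M \<noteq> V"
  obtains b where "b > 0" "M = frame_point a n V b 0" | d where "d > 0" "M = frame_point a n V 0 d"
proof -
  obtain \<xi> \<eta> where "M = V + \<xi> *\<^sub>R tensor (perp a) (perp a) + \<eta> *\<^sub>R tensor (perp n) (perp n)" "\<xi> \<ge> 0" "0 \<ge> \<eta>"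
    using M(1) unfolding upper_cone_def by blast
  then have eq: "M = frame_point a n V \<xi> (- \<eta>)" and s: "\<xi> \<ge> 0" "- \<eta> \<ge> 0" by (simp_all add: frame_point_def)
  have "\<xi> * (- \<eta>) = 0"
    using M(2) det_frame_point_diff[of a n V \<xi> "- \<eta>" 0 0] cone_frame_cross_nonzero[OF frame] by (simp add: eq)
  then consider "\<xi> = 0" | "- \<eta> = 0" by auto
  then show thesis
  proof cases
    case 1
    then have "- \<eta> \<noteq> 0" using M(3) eq by auto
    then show thesis using that(2)[of "- \<eta>"] s eq 1 by simp
  next
    case 2
    then have "\<xi> \<noteq> 0" using M(3) eq by auto
    then show thesis using that(1)[of \<xi>] s eq 2 by simp
  qed
qed

lemma mixtures_upper_cone:
  assumes Q: "Q \<in> sym_matrices" "det Q < 0" and frame: "cone_frame Q a n"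
    and plane: "\<U> \<subseteq> wells_plane Q \<delta>"
    and comp: "\<And>U. U \<in> \<U> \<Longrightarrow> \<exists>W\<in>\<U>. W \<noteq> U \<and> compatible U W" and nw: "\<not> wedge_configuration \<U>"
    and \<U>: "\<U> = {V, V', W', Z}" "distinct [V, V', W', Z]"
    and V': "V' \<in> upper_cone a n V" "det (V' - V) = 0" and W': "W' \<in> upper_cone a n V" "det (W' - V) = 0"
  shows "mixtures_in_lam_hull \<U>"
proof -
  have sym: "\<U> \<subseteq> sym_matrices" and V: "V \<in> sym_matrices" and Z: "Z \<in> sym_matrices"
    using plane by (auto simp: wells_plane_def \<U>(1))
  have ne: "V' \<noteq> V" "W' \<noteq> V" using \<U>(2) by auto
  have "Q \<bullet> (Z - V) = 0" using plane by (simp add: wells_plane_def \<U>(1) inner_diff_right)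
  then obtain x y where "Z - V = x *\<^sub>R tensor (perp a) (perp a) + y *\<^sub>R tensor (perp n) (perp n)"
    using cone_frame_coordinates[OF Q frame, of "Z - V"] V Z by auto
  then have Zp: "Z = frame_point a n V x (- y)" by (simp add: frame_point_def algebra_simps)
  have L: "mixtures_in_lam_hull \<U>"
    if "b > 0" "d > 0" "\<U> = {V, frame_point a n V b 0, frame_point a n V 0 d, Z}"
      "distinct [V, frame_point a n V b 0, frame_point a n V 0 d, Z]" for b d
  proof (rule mixtures_L_shape[OF frame V that(1,2) that(3,4)[unfolded Zp] _ nw])
    have "Z \<in> \<U>" by (simp add: \<U>(1))
    from comp[OF this] show "\<exists>M\<in>\<U>. M \<noteq> frame_point a n V x (- y) \<and> compatible (frame_point a n V x (- y)) M"
      unfolding Zp by blast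
  qed
  have detT: "det (tensor v v) = 0" for v by (simp add: det_2 tensor_def)
  have detT': "det (- tensor v v) = 0" for v by (simp add: det_2 tensor_def)
  show ?thesis
  \<comment> \<open>Two wells on the same leg give three wells on a ray; wells on different legs
    give the L.\<close>
  proof (rule upper_cone_rank_one[OF frame V' ne(1)]; rule upper_cone_rank_one[OF frame W' ne(2)])
    fix b c assume "b > 0" "V' = frame_point a n V b 0" "c > 0" "W' = frame_point a n V c 0"
    then show ?thesis
      by (intro mixtures_same_ray[where b = b and c = c, OF V \<U> sym _ _ detT[of "perp a"]]) (auto simp: frame_point_def)
  next
    fix b d assume "b > 0" "V' = frame_point a n V b 0" "d > 0" "W' = frame_point a n V 0 d"
    then show ?thesis using \<U> by (intro L[of b d]) auto
  next
    fix d b assume "d > 0" "V' = frame_point a n V 0 d" "b > 0" "W' = frame_point a n V b 0"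
    then show ?thesis using \<U> by (intro L[of b d]) auto
  next
    fix b c assume "b > 0" "V' = frame_point a n V 0 b" "c > 0" "W' = frame_point a n V 0 c"
    then show ?thesis
      by (intro mixtures_same_ray[where b = b and c = c, OF V \<U> sym _ _ detT'[of "perp n"]]) (auto simp: frame_point_def)
  qed
qed

lemma collinear_rank_one:
  assumes "Z \<in> convex hull {A, B}" "det (A - B) = 0"
  shows "det (Z - B) = (0::real)" "det (A - (Z::real^2^2)) = 0"
proof -
  obtain u v where "u + v = 1" and Z: "Z = u *\<^sub>R A + v *\<^sub>R B"
    using assms(1) by (auto simp: convex_hull_2)
  then have "v = 1 - u" by simp
  have "Z - B = u *\<^sub>R (A - B)" "A - Z = v *\<^sub>R (A - B)"
    unfolding Z \<open>v = 1 - u\<close> by (simp_all add: algebra_simps)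
  then show "det (Z - B) = 0" "det (A - Z) = 0" using assms(2) by (simp_all only: det_scaleR_2)
qed

lemma cone_frame_swap: "cone_frame Q a n \<Longrightarrow> cone_frame Q n a"
  by (auto simp: cone_frame_def insert_commute)

text \<open>Exchanging \<open>a\<close> and \<open>n\<close> mirrors the cone, which reduces the
  lower part to the upper one.\<close>

lemma lower_cone_eq_upper_cone: "lower_cone a n V = upper_cone n a V"
proof -
  have "V + \<xi> *\<^sub>R tensor (perp a) (perp a) + \<eta> *\<^sub>R tensor (perp n) (perp n)
      = V + \<eta> *\<^sub>R tensor (perp n) (perp n) + \<xi> *\<^sub>R tensor (perp a) (perp a)" for \<xi> \<eta>
    by simp
  then show ?thesis unfolding lower_cone_def upper_cone_def by (simp only:) blast
qed

text \<open>Pairs with a common well have hulls that meet there, so a disconnected \<open>D\<close>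
  forces the pairs to be disjoint and to exhaust the wells.\<close>

lemma mixtures_rank_one_pairs:
  assumes Q: "Q \<in> sym_matrices" "det Q < 0" and frame: "cone_frame Q a n"
    and plane: "\<U> \<subseteq> wells_plane Q \<delta>" and card: "card \<U> = 4"
    and comp: "\<And>U. U \<in> \<U> \<Longrightarrow> \<exists>V\<in>\<U>. V \<noteq> U \<and> compatible U V"
    and nw: "\<not> wedge_configuration \<U>"
    and V12: "{V1, V2} \<subseteq> \<U>" "V1 \<noteq> V2" "det (V1 - V2) = 0"
    and W12: "{W1, W2} \<subseteq> \<U>" "W1 \<noteq> W2" "det (W1 - W2) = 0"
    and ne: "{V1, V2} \<noteq> {W1, W2}"
    and D: "D = convex hull {W1, W2} \<union> convex hull {V1, V2}"
    and cases: "\<not> connected D \<or> \<U> \<subseteq> D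
       \<or> (\<exists>V. {V1, V2} \<inter> {W1, W2} = {V} \<and> (D \<subseteq> upper_cone a n V \<or> D \<subseteq> lower_cone a n V))"
  shows "mixtures_in_lam_hull \<U>"
proof (cases "{V1, V2} \<inter> {W1, W2} = {}")
  case True
  then have d: "distinct [V1, V2, W1, W2]" using V12(2) W12(2) by auto
  then have "card {V1, V2, W1, W2} = 4" by simp
  moreover have "finite \<U>" using card by (simp add: card_ge_0_finite)
  ultimately have "{V1, V2, W1, W2} = \<U>"
    using V12(1) W12(1) card by (intro card_subset_eq) auto
  then show ?thesis
    using d V12(3) W12(3) plane
    by (intro mixtures_two_rank_one_pairs[of \<U> V1 V2 W1 W2]) (auto simp: wells_plane_def)
next
  case False
  have fin: "finite \<U>" using card by (simp add: card_ge_0_finite)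
  obtain V V' W' where V: "{V1, V2} = {V, V'}" "{W1, W2} = {V, W'}" "V' \<noteq> V" "W' \<noteq> V" "V' \<noteq> W'"
  proof -
    have other: "\<exists>Y. {A, B} = {X, Y}" if "X \<in> {A, B}" for X A B :: "real^2^2"
      using that by (cases "X = A") (blast, simp add: insert_commute, blast)
    from False obtain V where "V \<in> {V1, V2}" "V \<in> {W1, W2}" by blast
    then obtain V' W' where "{V1, V2} = {V, V'}" "{W1, W2} = {V, W'}" using other by meson
    moreover have "V' \<noteq> V" "W' \<noteq> V" using calculation V12(2) W12(2) by (auto simp: doubleton_eq_iff)
    moreover have "V' \<noteq> W'" using calculation ne by auto
    ultimately show thesis by (rule that)
  qed
  have dV: "det (V' - V) = 0" and dW: "det (W' - V) = 0"
    using V12(3) W12(3) V(1,2) det_minus_commute by (auto simp: doubleton_eq_iff)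
  have "{V, V', W'} \<subseteq> \<U>" using V12(1) W12(1) V(1,2) by auto
  have "card (\<U> - {V, V', W'}) = 1"
    using \<open>{V, V', W'} \<subseteq> \<U>\<close> V(3-5) card by (subst card_Diff_subset) auto
  then obtain Z where Z: "\<U> - {V, V', W'} = {Z}" by (auto simp: card_1_singleton_iff)
  then have \<U>: "\<U> = {V, V', W', Z}" "distinct [V, V', W', Z]"
    using \<open>{V, V', W'} \<subseteq> \<U>\<close> V(3-5) by auto
  have sym: "\<U> \<subseteq> sym_matrices" using plane by (auto simp: wells_plane_def)
  have D': "D = convex hull {V, W'} \<union> convex hull {V, V'}" using D V by simp
  have "connected D"
  proof -
    have "V \<in> convex hull {V, W'} \<inter> convex hull {V, V'}" by (simp add: hull_inc)
    then show ?thesis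
      unfolding D' by (intro connected_Un convex_connected convex_convex_hull) blast
  qed
  with cases consider "\<U> \<subseteq> D" | U where "{V1, V2} \<inter> {W1, W2} = {U}" "D \<subseteq> upper_cone a n U \<or> D \<subseteq> lower_cone a n U"
    by blast
  then show ?thesis
  proof cases
    case 1
    \<comment> \<open>A fourth well on one segment pairs with the outer end of that segment and
      leaves the corner to the other pair, which again gives two disjoint rank-one pairs.\<close>
    then have "Z \<in> convex hull {V, W'} \<or> Z \<in> convex hull {V, V'}" using \<U>(1) D' by auto
    then show ?thesis
    proof
      assume "Z \<in> convex hull {V, W'}"
      from collinear_rank_one[OF this] dW have "det (Z - W') = 0" by (simp add: det_minus_commute[of W' V])
      then show ?thesis
        using \<U> sym dV by (intro mixtures_two_rank_one_pairs[of \<U> Z W' V' V]) auto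
    next
      assume "Z \<in> convex hull {V, V'}"
      from collinear_rank_one[OF this] dV have "det (Z - V') = 0" by (simp add: det_minus_commute[of V' V])
      then show ?thesis
        using \<U> sym dW by (intro mixtures_two_rank_one_pairs[of \<U> Z V' W' V]) auto
    qed
  next
    case 2
    have "{V1, V2} \<inter> {W1, W2} = {V}" unfolding V(1,2) using V(3-5) by auto
    with 2(1) have "U = V" by auto
    have mem: "V' \<in> D" "W' \<in> D" unfolding D' by (auto simp: hull_inc)
    from 2(2) show ?thesis
    proof
      assume "D \<subseteq> upper_cone a n U"
      then show ?thesis
        using mem \<open>U = V\<close> by (intro mixtures_upper_cone[OF Q frame plane comp nw \<U> _ dV _ dW]) auto
    next
      assume "D \<subseteq> lower_cone a n U"
      then show ?thesis
        using mem \<open>U = V\<close> lower_cone_eq_upper_cone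
        by (intro mixtures_upper_cone[OF Q cone_frame_swap[OF frame] plane comp nw \<U> _ dV _ dW]) auto
    qed
  qed
qed

theorem theorem2p2:
  fixes Q :: "real^2^2" and \<delta> :: real and a n :: "real^2"
    and \<U> :: "(real^2^2) set" and V1 V2 W1 W2 :: "real^2^2" and D :: "(real^2^2) set"
  assumes "Q \<in> sym_matrices" and "det Q < 0"
    and "cone_frame Q a n"
    and "\<U> \<subseteq> wells_plane Q \<delta>" and "card \<U> = 4"
    and "\<And>U. U \<in> \<U> \<Longrightarrow> \<exists>V\<in>\<U>. V \<noteq> U \<and> compatible U V"
    and "\<not> wedge_configuration \<U>"
    and "{V1, V2} \<subseteq> \<U>" and "V1 \<noteq> V2" and "rank_one_compatible V1 V2"
    and "{W1, W2} \<subseteq> \<U>" and "W1 \<noteq> W2" and "rank_one_compatible W1 W2"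
    and "{V1, V2} \<noteq> {W1, W2}"
    and "D = convex hull {W1, W2} \<union> convex hull {V1, V2}"
    and "\<not> connected D
       \<or> connected D \<and> \<U> \<subseteq> D
       \<or> (\<exists>V. {V1, V2} \<inter> {W1, W2} = {V} \<and>
            (D \<subseteq> planar_cone_boundary Q \<delta> V \<inter> upper_cone a n V \<or>
             D \<subseteq> planar_cone_boundary Q \<delta> V \<inter> lower_cone a n V))"
  shows "sym_lam_hull \<U> = sym_qc_hull \<U>"
proof
  have sym: "\<U> \<subseteq> sym_matrices" using assms(4) by (auto simp: wells_plane_def)
  then show "sym_lam_hull \<U> \<subseteq> sym_qc_hull \<U>" by (rule sym_lam_hull_subset_qc_hull)
  have "det (V1 - V2) = 0" "det (W1 - W2) = 0"
    using assms(10,13) unfolding rank_one_compatible_def rank_le_1_iff_det by blast+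
  moreover have "\<not> connected D \<or> \<U> \<subseteq> D
       \<or> (\<exists>V. {V1, V2} \<inter> {W1, W2} = {V} \<and> (D \<subseteq> upper_cone a n V \<or> D \<subseteq> lower_cone a n V))"
    using assms(16) by blast
  ultimately have mix: "mixtures_in_lam_hull \<U>"
    by (intro mixtures_rank_one_pairs[OF assms(1-7,8,9) _ assms(11,12) _ assms(14,15)])
  show "sym_qc_hull \<U> \<subseteq> sym_lam_hull \<U>"
  proof
    fix A assume A: "A \<in> sym_qc_hull \<U>"
    have fin: "finite \<U>" using assms(5) by (simp add: card_ge_0_finite)
    show "A \<in> sym_lam_hull \<U>"
    proof (rule sym_qc_hull_weights[OF fin A])
      fix w
      assume w: "\<And>M. M \<in> \<U> \<Longrightarrow> w M \<ge> 0" "sum w \<U> = 1" "(\<Sum>M\<in>\<U>. w M *\<^sub>R M) = A"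
        "(\<Sum>M\<in>\<U>. w M * det M) \<le> det A"
      have "(\<Sum>M\<in>\<U>. w M *\<^sub>R M) \<in> sym_lam_hull \<U>"
        by (rule mix[unfolded mixtures_in_lam_hull_def, rule_format]) (use w in auto)
      then show "A \<in> sym_lam_hull \<U>" unfolding w(3) .
    qed
  qed
qed

end
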